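(* Let $f$ be a morphism in $\mathsf{Bialg}$ and let $f=f_1\otimes\cdots\otimes f_k$ be its $\otimes$-decomposition, i.e. each $f_i$ is not $\otimes$-decomposable. Let $r_i=\mathrm{rank}(\mathsf M(f_i))$. Then $$\max\{r_1,\dots,r_k\}\ \le\ \mathrm{mwd}(f)\ \le\ \max\{r_1,\dots,r_k\}+1 .$$
   Context: $\mathsf{Mat}_{\mathbb N}$ is the strict symmetric monoidal category (prop) with natural numbers as objects, morphisms $n\to m$ the $m\times n$ matrices over $\mathbb N$, composition matrix multiplication, and monoidal product addition on objects and block diagonal sum $A\otimes B=\begin{pmatrix}A&0\\0&B\end{pmatrix}$ on matrices (matrices with zero rows or columns allowed). $\mathsf{Bialg}$ is the prop generated by copy $\delta\colon 1\to2$, delete $\epsilon\colon 1\to 0$, add $\mu\colon 2\to1$, zero $\eta\colon 0\to1$ modulo the (commutative and cocommutative) bialgebra axioms; there is an isomorphism of props $\mathsf M\colon\mathsf{Bialg}\to\mathsf{Mat}_{\mathbb N}$ with $\mathsf M(\delta)=\begin{pmatrix}1\\1\end{pmatrix}$, $\mathsf M(\mu)=\begin{pmatrix}1&1\end{pmatrix}$, $\mathsf M(\epsilon)$ the $0\times1$ matrix and $\mathsf M(\eta)$ the $1\times0$ matrix. Composition $f;g$ is written in diagrammatic order. $\mathrm{rank}(A)$, for $A\colon n\to m$ in $\mathsf{Mat}_{\mathbb N}$, is the least $k$ such that $A$ factors as a composite $n\to k\to m$ in $\mathsf{Mat}_{\mathbb N}$. A morphism $f$ is not $\otimes$-decomposable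 if there are no $f_1,f_2$, both distinct from $f$, such that $f=f_1\otimes f_2$. Monoidal width in $\mathsf{Bialg}$: the atomic morphisms are $\delta,\epsilon,\mu,\eta$, the symmetry $\sigma_{1,1}\colon2\to2$ and $\mathrm{id}_1$. A monoidal decomposition of $f$ is inductively: a leaf labelled $f$ if $f$ is atomic; a node $(d_1,\otimes,d_2)$ where $d_i$ is a monoidal decomposition of $f_i$ and $f=f_1\otimes f_2$; or a node $(d_1,;_j,d_2)$ where $d_1,d_2$ are monoidal decompositions of $f_1\colon n\to j$, $f_2\colon j\to m$ and $f=f_1;f_2$. Widths: a leaf labelled by atomic $f\colon n\to m$ has width $\max\{m,n\}$; $\mathrm{wd}(d_1,\otimes,d_2)=\max\{\mathrm{wd}(d_1),\mathrm{wd}(d_2)\}$; $\mathrm{wd}(d_1,;_j,d_2)=\max\{\mathrm{wd}(d_1),j,\mathrm{wd}(d_2)\}$. $\mathrm{mwd}(f)$ is the minimum width of a monoidal decomposition of $f$. *)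

theory Defs
  imports "Jordan_Normal_Form.Matrix"
begin

section \<open>Matrices over the natural numbers\<close>

text \<open>A morphism \<open>n \<rightarrow> m\<close> of the prop of matrices is an \<open>m \<times> n\<close> matrix; diagrammatic composition
  \<open>A ; B\<close> is the product \<open>B * A\<close>.\<close>

definition dsum :: "nat mat \<Rightarrow> nat mat \<Rightarrow> nat mat" where
  "dsum A B = four_block_mat A (0\<^sub>m (dim_row A) (dim_col B)) (0\<^sub>m (dim_row B) (dim_col A)) B"

text \<open>The matrix of the symmetry \<open>n + m \<rightarrow> m + n\<close>.\<close>

definition swap_mat :: "nat \<Rightarrow> nat \<Rightarrow> nat mat" where
  "swap_mat n m = four_block_mat (0\<^sub>m m n) (1\<^sub>m m) (1\<^sub>m n) (0\<^sub>m n m)"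

definition mat_rank :: "nat mat \<Rightarrow> nat" where
  "mat_rank A = (LEAST k. \<exists>B \<in> carrier_mat k (dim_col A). \<exists>C \<in> carrier_mat (dim_row A) k. A = C * B)"


section \<open>The prop of bialgebras\<close>

datatype bterm =
    Copy | Del | Add | Zero
  | Ident nat
  | Swap nat nat
  | Seq bterm bterm
  | Par bterm bterm

primrec tdom :: "bterm \<Rightarrow> nat" where
  "tdom Copy = 1"
| "tdom Del = 1"
| "tdom Add = 2"
| "tdom Zero = 0"
| "tdom (Ident n) = n"
| "tdom (Swap n m) = n + m"
| "tdom (Seq s t) = tdom s"
| "tdom (Par s t) = tdom s + tdom t"

primrec tcod :: "bterm \<Rightarrow> nat" where
  "tcod Copy = 2"
| "tcod Del = 0"
| "tcod Add = 1"
| "tcod Zero = 1"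
| "tcod (Ident n) = n"
| "tcod (Swap n m) = m + n"
| "tcod (Seq s t) = tcod t"
| "tcod (Par s t) = tcod s + tcod t"

primrec wf_bterm :: "bterm \<Rightarrow> bool" where
  "wf_bterm Copy = True"
| "wf_bterm Del = True"
| "wf_bterm Add = True"
| "wf_bterm Zero = True"
| "wf_bterm (Ident n) = True"
| "wf_bterm (Swap n m) = True"
| "wf_bterm (Seq s t) = (wf_bterm s \<and> wf_bterm t \<and> tcod s = tdom t)"
| "wf_bterm (Par s t) = (wf_bterm s \<and> wf_bterm t)"

text \<open>Equality of well-formed terms modulo the laws of strict symmetric monoidal categories and
  the commutative and cocommutative bialgebra axioms. Ill-formed terms are related to nothing.\<close>

inductive beq :: "bterm \<Rightarrow> bterm \<Rightarrow> bool" (infix "\<approx>" 50) where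
  refl: "wf_bterm s \<Longrightarrow> s \<approx> s"
| sym: "s \<approx> t \<Longrightarrow> t \<approx> s"
| trans: "s \<approx> t \<Longrightarrow> t \<approx> u \<Longrightarrow> s \<approx> u"
| seq_cong: "s \<approx> s' \<Longrightarrow> t \<approx> t' \<Longrightarrow> tcod s = tdom t \<Longrightarrow> Seq s t \<approx> Seq s' t'"
| par_cong: "s \<approx> s' \<Longrightarrow> t \<approx> t' \<Longrightarrow> Par s t \<approx> Par s' t'"

| seq_assoc: "wf_bterm s \<Longrightarrow> wf_bterm t \<Longrightarrow> wf_bterm u \<Longrightarrow> tcod s = tdom t \<Longrightarrow> tcod t = tdom u \<Longrightarrow>
    Seq (Seq s t) u \<approx> Seq s (Seq t u)"
| seq_id_left: "wf_bterm s \<Longrightarrow> Seq (Ident (tdom s)) s \<approx> s"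
| seq_id_right: "wf_bterm s \<Longrightarrow> Seq s (Ident (tcod s)) \<approx> s"
| par_assoc: "wf_bterm s \<Longrightarrow> wf_bterm t \<Longrightarrow> wf_bterm u \<Longrightarrow> Par (Par s t) u \<approx> Par s (Par t u)"
| par_unit_left: "wf_bterm s \<Longrightarrow> Par (Ident 0) s \<approx> s"
| par_unit_right: "wf_bterm s \<Longrightarrow> Par s (Ident 0) \<approx> s"
| par_id: "Par (Ident n) (Ident m) \<approx> Ident (n + m)"
| interchange: "wf_bterm s \<Longrightarrow> wf_bterm t \<Longrightarrow> wf_bterm s' \<Longrightarrow> wf_bterm t' \<Longrightarrow>
    tcod s = tdom t \<Longrightarrow> tcod s' = tdom t' \<Longrightarrow>
    Par (Seq s t) (Seq s' t') \<approx> Seq (Par s s') (Par t t')"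
| swap_nat: "wf_bterm s \<Longrightarrow> wf_bterm t \<Longrightarrow>
    Seq (Par s t) (Swap (tcod s) (tcod t)) \<approx> Seq (Swap (tdom s) (tdom t)) (Par t s)"
| swap_inv: "Seq (Swap n m) (Swap m n) \<approx> Ident (n + m)"
| swap_hex: "Swap n (m + k) \<approx> Seq (Par (Swap n m) (Ident k)) (Par (Ident m) (Swap n k))"

| copy_assoc: "Seq Copy (Par Copy (Ident 1)) \<approx> Seq Copy (Par (Ident 1) Copy)"
| copy_unit: "Seq Copy (Par Del (Ident 1)) \<approx> Ident 1"
| copy_comm: "Seq Copy (Swap 1 1) \<approx> Copy"
| add_assoc: "Seq (Par Add (Ident 1)) Add \<approx> Seq (Par (Ident 1) Add) Add"
| add_unit: "Seq (Par Zero (Ident 1)) Add \<approx> Ident 1"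
| add_comm: "Seq (Swap 1 1) Add \<approx> Add"
| add_copy: "Seq Add Copy \<approx>
    Seq (Par Copy Copy) (Seq (Par (Ident 1) (Par (Swap 1 1) (Ident 1))) (Par Add Add))"
| add_del: "Seq Add Del \<approx> Par Del Del"
| zero_copy: "Seq Zero Copy \<approx> Par Zero Zero"
| zero_del: "Seq Zero Del \<approx> Ident 0"

lemma beq_wf: "s \<approx> t \<Longrightarrow> wf_bterm s \<and> wf_bterm t \<and> tdom s = tdom t \<and> tcod s = tcod t"
  by (induction rule: beq.induct) auto

quotient_type bialg = bterm / partial: beq
proof (rule part_equivpI)
  show "\<exists>s. s \<approx> s" using beq.refl[of Copy] by auto
  show "symp (\<approx>)" by (auto intro: sympI beq.sym)
  show "transp (\<approx>)" by (auto intro: transpI beq.trans)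
qed

lift_definition bdom :: "bialg \<Rightarrow> nat" is tdom using beq_wf by blast
lift_definition bcod :: "bialg \<Rightarrow> nat" is tcod using beq_wf by blast

lift_definition copy :: bialg is Copy by (simp add: beq.refl)
lift_definition del :: bialg is Del by (simp add: beq.refl)
lift_definition add :: bialg is Add by (simp add: beq.refl)
lift_definition zero :: bialg is Zero by (simp add: beq.refl)
lift_definition ident :: "nat \<Rightarrow> bialg" is Ident by (simp add: beq.refl)
lift_definition swap :: "nat \<Rightarrow> nat \<Rightarrow> bialg" is Swap by (simp add: beq.refl)

lift_definition tensor :: "bialg \<Rightarrow> bialg \<Rightarrow> bialg" (infixr "\<otimes>\<^sub>B" 70) is Par
  by (rule beq.par_cong)

text \<open>Diagrammatic composition; \<open>f ;; g\<close> is meaningful only if \<open>bcod f = bdom g\<close>.\<close>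

lift_definition seq :: "bialg \<Rightarrow> bialg \<Rightarrow> bialg" (infixr ";;" 65)
  is "\<lambda>s t. if tcod s = tdom t then Seq s t else Ident 0"
  using beq_wf by (auto intro: beq.refl beq.seq_cong)


section \<open>The matrix of a morphism\<close>

primrec tmat :: "bterm \<Rightarrow> nat mat" where
  "tmat Copy = mat 2 1 (\<lambda>_. 1)"
| "tmat Del = 0\<^sub>m 0 1"
| "tmat Add = mat 1 2 (\<lambda>_. 1)"
| "tmat Zero = 0\<^sub>m 1 0"
| "tmat (Ident n) = 1\<^sub>m n"
| "tmat (Swap n m) = swap_mat n m"
| "tmat (Seq s t) = tmat t * tmat s"
| "tmat (Par s t) = dsum (tmat s) (tmat t)"

lemma dsum_carrier: "A \<in> carrier_mat a b \<Longrightarrow> B \<in> carrier_mat c d \<Longrightarrow> dsum A B \<in> carrier_mat (a + c) (b + d)"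
  by (auto simp: dsum_def)

lemma swap_mat_carrier: "swap_mat n m \<in> carrier_mat (m + n) (n + m)"
  unfolding swap_mat_def by (rule carrier_matI) simp_all

lemma tmat_carrier: "wf_bterm t \<Longrightarrow> tmat t \<in> carrier_mat (tcod t) (tdom t)"
proof (induction t)
  case (Seq s t)
  then show ?case by (auto intro: mult_carrier_mat)
next
  case (Par s t)
  then show ?case by (auto intro: dsum_carrier)
next
  case (Swap n m)
  show ?case by (simp add: swap_mat_carrier)
qed simp_all

lemma dsum_mult:
  assumes "A \<in> carrier_mat a b" "A' \<in> carrier_mat b c" "B \<in> carrier_mat d e" "B' \<in> carrier_mat e f"
  shows "dsum A B * dsum A' B' = dsum (A * A') (B * B')"
  unfolding dsum_def using assms
  by (subst mult_four_block_mat[of _ a b _ e _ d _ _ c _ f]) auto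

lemma dsum_swap:
  assumes "A \<in> carrier_mat a b" "B \<in> carrier_mat c d"
  shows "swap_mat a c * dsum A B = dsum B A * swap_mat b d"
  unfolding dsum_def swap_mat_def using assms
  apply (subst mult_four_block_mat[of _ c a _ c _ a _ _ b _ d]; (simp; fail)?)
  apply (subst mult_four_block_mat[of _ c d _ b _ a _ _ b _ d]; (simp; fail)?)
  done

lemma dsum_assoc: "dsum (dsum A B) C = dsum A (dsum B C)"
  unfolding dsum_def using assoc_four_block_mat[of A B C] by simp

lemma swap_mat_inv: "swap_mat m n * swap_mat n m = 1\<^sub>m (n + m)"
  unfolding swap_mat_def
  by (subst mult_four_block_mat[of _ n m _ n _ m _ _ n _ m]) auto

lemma swap_mat_index:
  assumes "i < m + n" "j < n + m"
  shows "swap_mat n m $$ (i, j) = (if j = (if i < m then i + n else i - m) then 1 else 0)"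
  using assms unfolding swap_mat_def by (cases "i < m"; cases "j < n") auto

lemma swap_mat_hex:
  "swap_mat n (m + k) = dsum (1\<^sub>m m) (swap_mat n k) * dsum (swap_mat n m) (1\<^sub>m k)"
proof (rule eq_matI)
  define A where "A = dsum (1\<^sub>m m) (swap_mat n k)"
  define B where "B = dsum (swap_mat n m) (1\<^sub>m k)"
  have dim: "A \<in> carrier_mat (m + (k + n)) (m + (n + k))" "B \<in> carrier_mat (m + n + k) (n + m + k)"
    unfolding A_def B_def by (auto intro!: dsum_carrier swap_mat_carrier)
  have sdim: "dim_row (swap_mat a b) = b + a" "dim_col (swap_mat a b) = a + b" for a b
    using swap_mat_carrier[of a b] by auto
  have A: "A $$ (i, j) = (if j = (if i < m then i else if i < m + k then i + n else i - k) then 1 else 0)"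
    if "i < m + k + n" "j < m + n + k" for i j
    using that unfolding A_def dsum_def
    by (cases "i < m"; cases "j < m") (auto simp: sdim swap_mat_index)
  have B: "B $$ (i, j) = (if j = (if i < m then i + n else if i < m + n then i - m else i) then 1 else 0)"
    if "i < m + n + k" "j < n + m + k" for i j
    using that unfolding B_def dsum_def
    by (cases "i < m + n"; cases "j < n + m") (auto simp: sdim swap_mat_index)
  fix i j
  assume "i < dim_row (dsum (1\<^sub>m m) (swap_mat n k) * dsum (swap_mat n m) (1\<^sub>m k))"
    and "j < dim_col (dsum (1\<^sub>m m) (swap_mat n k) * dsum (swap_mat n m) (1\<^sub>m k))"
  then have i: "i < m + k + n" and j: "j < n + m + k"
    using dim by (auto simp: A_def[symmetric] B_def[symmetric])
  define l where "l = (if i < m then i else if i < m + k then i + n else i - k)"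
  have l: "l < m + n + k" using i by (auto simp: l_def)
  have "(A * B) $$ (i, j) = (\<Sum>x = 0..<m + n + k. A $$ (i, x) * B $$ (x, j))"
    using i j dim by (simp add: scalar_prod_def)
  also have "\<dots> = (\<Sum>x = 0..<m + n + k. if x = l then B $$ (x, j) else 0)"
    using i by (intro sum.cong) (auto simp: A l_def[symmetric])
  also have "\<dots> = B $$ (l, j)"
    using l by (simp add: sum.delta)
  also have "\<dots> = (if j = (if i < m + k then i + n else i - (m + k)) then 1 else 0)"
    unfolding B[OF l j] using i by (auto simp: l_def)
  also have "\<dots> = swap_mat n (m + k) $$ (i, j)"
    using i j by (simp add: swap_mat_index)
  finally show "swap_mat n (m + k) $$ (i, j) =
      (dsum (1\<^sub>m m) (swap_mat n k) * dsum (swap_mat n m) (1\<^sub>m k)) $$ (i, j)"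
    by (simp add: A_def B_def)
qed (auto simp: swap_mat_def dsum_def)

lemmas concrete_simps =
  dsum_def swap_mat_def scalar_prod_def numeral_2_eq_2 less_Suc_eq sum.atLeast0_lessThan_Suc

lemma tmat_sound: "s \<approx> t \<Longrightarrow> tmat s = tmat t"
proof (induction rule: beq.induct)
  case (seq_assoc s t u)
  then show ?case
    using tmat_carrier[of s] tmat_carrier[of t] tmat_carrier[of u] by simp
next
  case (seq_id_left s)
  then show ?case using tmat_carrier[of s] by simp
next
  case (seq_id_right s)
  then show ?case using tmat_carrier[of s] by simp
next
  case (par_assoc s t u)
  show ?case by (simp add: dsum_assoc)
next
  case (par_unit_left s)
  show ?case by (rule eq_matI) (auto simp: dsum_def)
next
  case (par_unit_right s)
  show ?case by (rule eq_matI) (auto simp: dsum_def)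
next
  case (par_id n m)
  show ?case by (simp add: dsum_def)
next
  case (interchange s t s' t')
  then show ?case
    using dsum_mult[OF tmat_carrier[of t] _ tmat_carrier[of t'], of "tmat s" _ "tmat s'"]
      tmat_carrier[of s] tmat_carrier[of s'] by simp
next
  case (swap_nat s t)
  then show ?case
    using dsum_swap[OF tmat_carrier[of s] tmat_carrier[of t]] by simp
next
  case (swap_inv n m)
  show ?case by (simp add: swap_mat_inv)
next
  case (swap_hex n m k)
  show ?case by (simp add: swap_mat_hex)
next
  case copy_assoc
  show ?case by (rule eq_matI) (auto simp: concrete_simps)
next
  case copy_unit
  show ?case by (rule eq_matI) (auto simp: concrete_simps)
next
  case copy_comm
  show ?case by (rule eq_matI) (auto simp: concrete_simps)
next
  case add_assoc
  show ?case by (rule eq_matI) (auto simp: concrete_simps)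
next
  case add_unit
  show ?case by (rule eq_matI) (auto simp: concrete_simps)
next
  case add_comm
  show ?case by (rule eq_matI) (auto simp: concrete_simps)
next
  case add_copy
  show ?case by (rule eq_matI) (auto simp: concrete_simps)
next
  case add_del
  show ?case by (rule eq_matI) (auto simp: concrete_simps)
next
  case zero_copy
  show ?case by (rule eq_matI) (auto simp: concrete_simps)
next
  case zero_del
  show ?case by (rule eq_matI) (auto simp: concrete_simps)
qed auto

lift_definition M :: "bialg \<Rightarrow> nat mat" is tmat by (rule tmat_sound)


section \<open>Tensor decompositions\<close>

definition tensor_decomposable :: "bialg \<Rightarrow> bool" where
  "tensor_decomposable f \<longleftrightarrow> (\<exists>f1 f2. f1 \<noteq> f \<and> f2 \<noteq> f \<and> f = f1 \<otimes>\<^sub>B f2)"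

definition tensor_list :: "bialg list \<Rightarrow> bialg" where
  "tensor_list fs = foldr (\<otimes>\<^sub>B) fs (ident 0)"


section \<open>Monoidal width\<close>

definition atomic :: "bialg set" where
  "atomic = {copy, del, add, zero, swap 1 1, ident 1}"

datatype mdecomp =
    Leaf bialg
  | TensorNode mdecomp mdecomp
  | SeqNode mdecomp nat mdecomp

inductive decomp_of :: "mdecomp \<Rightarrow> bialg \<Rightarrow> bool" where
  "f \<in> atomic \<Longrightarrow> decomp_of (Leaf f) f"
| "decomp_of d1 f1 \<Longrightarrow> decomp_of d2 f2 \<Longrightarrow> decomp_of (TensorNode d1 d2) (f1 \<otimes>\<^sub>B f2)"
| "decomp_of d1 f1 \<Longrightarrow> decomp_of d2 f2 \<Longrightarrow> bcod f1 = j \<Longrightarrow> bdom f2 = j \<Longrightarrow>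
    decomp_of (SeqNode d1 j d2) (f1 ;; f2)"

primrec width :: "mdecomp \<Rightarrow> nat" where
  "width (Leaf f) = max (bcod f) (bdom f)"
| "width (TensorNode d1 d2) = max (width d1) (width d2)"
| "width (SeqNode d1 j d2) = Max {width d1, j, width d2}"

definition mwd :: "bialg \<Rightarrow> nat" where
  "mwd f = (LEAST w. \<exists>d. decomp_of d f \<and> width d = w)"

end

theory Submission
  imports Defs
begin

text \<open>
  Both bounds are statements about matrices, since the matrix semantics is faithful
  (\<open>M_injective\<close>) and full (\<open>M_surjective\<close>). Faithfulness is proved by showing that the tensor
  product is a coproduct. Componentwise addition is natural with respect to every morphism
  (\<open>adder_natural\<close>), so a morphism is determined by its restrictions to single inputs; and a
  morphism out of \<open>1\<close> followed by \<open>f\<close> is computed by the matrix of \<open>f\<close> once it is in the normal form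
  of a column vector (\<open>column_seq\<close>).

  For the upper bound, factor the matrix of a morphism as \<open>C * B\<close> through its rank \<open>r\<close>. The matrix \<open>B\<close>
  has \<open>r\<close> rows, and it can be evaluated by reading its inputs one after another while keeping the \<open>r\<close>
  partial sums: if \<open>B'\<close> is \<open>B\<close> without its last column \<open>b\<close>, then \<open>B = [I | b] * (B' \<oplus> 1)\<close>. Only \<open>r + 1\<close>
  wires are cut here, and adding multiples of one wire to \<open>r\<close> others is possible within width \<open>r + 1\<close>
  by letting that wire move past them (\<open>narrow_add_last\<close>). The matrix \<open>C\<close> is treated by transposition.
  A tensor product of such decompositions has the maximal width of its factors. The extra wire gives
  the summand \<open>1\<close> of the theorem.

  For the lower bound, follow an indecomposable tensor factor, seen as a block of the matrix, down an
  arbitrary monoidal decomposition (\<open>mat_rank_le_width\<close>). A tensor node cannot split the block, so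
  it lies entirely in one of the two subtrees, unless it has no rows or no columns and so rank \<open>0\<close>.
  The descent ends at a leaf or at a composition along \<open>j\<close> wires. In the latter case the block factors
  through \<open>j\<close>, so its rank is at most \<open>j\<close>, which is at most the width.
\<close>

section \<open>Calculating in the prop of bialgebras\<close>

text \<open>The object \<open>1\<close> occurs in almost every law below; rewriting it to \<open>Suc 0\<close> would keep these laws
  from matching.\<close>

declare One_nat_def [simp del]

lemma beq_refl_iff: "s \<approx> s \<longleftrightarrow> wf_bterm s"
  using beq_wf beq.refl by blast

text \<open>The quotient is partial, so a transferred statement about all morphisms quantifies over the
  self-related terms; this rule lets transfer present them as the well-formed ones.\<close>

lemma wf_domain [transfer_domain_rule]: "Domainp pcr_bialg = wf_bterm"
  by (simp add: bialg.domain_eq beq_refl_iff)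

lemma bdom_bcod_generators [simp]:
  "bdom copy = 1" "bcod copy = 2" "bdom del = 1" "bcod del = 0"
  "bdom add = 2" "bcod add = 1" "bdom zero = 0" "bcod zero = 1"
  "bdom (ident n) = n" "bcod (ident n) = n"
  "bdom (swap n m) = n + m" "bcod (swap n m) = m + n"
  by (transfer; simp)+

lemma bdom_bcod_tensor [simp]:
  "bdom (f \<otimes>\<^sub>B g) = bdom f + bdom g" "bcod (f \<otimes>\<^sub>B g) = bcod f + bcod g"
  by (transfer; simp)+

lemma bdom_bcod_seq [simp]:
  "bcod f = bdom g \<Longrightarrow> bdom (f ;; g) = bdom f"
  "bcod f = bdom g \<Longrightarrow> bcod (f ;; g) = bcod g"
  by (transfer; simp)+

lemma seq_assoc:
  "bcod f = bdom g \<Longrightarrow> bcod g = bdom h \<Longrightarrow> (f ;; g) ;; h = f ;; g ;; h"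
  by transfer (auto intro: beq.seq_assoc)

lemma seq_ident_left [simp]: "n = bdom f \<Longrightarrow> ident n ;; f = f"
  by transfer (auto intro: beq.seq_id_left)

lemma seq_ident_right [simp]: "n = bcod f \<Longrightarrow> f ;; ident n = f"
  by transfer (auto intro: beq.seq_id_right)

lemma tensor_assoc: "(f \<otimes>\<^sub>B g) \<otimes>\<^sub>B h = f \<otimes>\<^sub>B g \<otimes>\<^sub>B h"
  by transfer (auto intro: beq.par_assoc)

lemma tensor_ident_0 [simp]: "ident 0 \<otimes>\<^sub>B f = f" "f \<otimes>\<^sub>B ident 0 = f"
  by (transfer; auto intro: beq.par_unit_left beq.par_unit_right)+

lemma tensor_ident: "ident n \<otimes>\<^sub>B ident m = ident (n + m)"
  by transfer (rule beq.par_id)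

lemma interchange:
  "bcod f = bdom f' \<Longrightarrow> bcod g = bdom g' \<Longrightarrow>
    (f \<otimes>\<^sub>B g) ;; (f' \<otimes>\<^sub>B g') = (f ;; f') \<otimes>\<^sub>B (g ;; g')"
  by transfer (auto intro: beq.interchange beq.sym)

lemma whisker_left: "bcod f = bdom g \<Longrightarrow> ident n \<otimes>\<^sub>B (f ;; g) = (ident n \<otimes>\<^sub>B f) ;; (ident n \<otimes>\<^sub>B g)"
  by (simp add: interchange)

lemma whisker_right: "bcod f = bdom g \<Longrightarrow> (f ;; g) \<otimes>\<^sub>B ident n = (f \<otimes>\<^sub>B ident n) ;; (g \<otimes>\<^sub>B ident n)"
  by (simp add: interchange)

lemma swap_natural:
  "bcod f = m \<Longrightarrow> bcod g = m' \<Longrightarrow> (f \<otimes>\<^sub>B g) ;; swap m m' = swap (bdom f) (bdom g) ;; (g \<otimes>\<^sub>B f)"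
  by transfer (auto intro: beq.swap_nat)

lemma swap_swap: "swap n m ;; swap m n = ident (n + m)"
  by transfer (auto intro: beq.swap_inv)

lemma swap_right_add:
  "swap n (m + k) = (swap n m \<otimes>\<^sub>B ident k) ;; (ident m \<otimes>\<^sub>B swap n k)"
  by transfer (auto intro: beq.swap_hex)

lemma copy_coassoc: "copy ;; (copy \<otimes>\<^sub>B ident 1) = copy ;; (ident 1 \<otimes>\<^sub>B copy)"
  by transfer (auto intro: beq.copy_assoc[simplified])
lemma copy_counit_left: "copy ;; (del \<otimes>\<^sub>B ident 1) = ident 1"
  by transfer (auto intro: beq.copy_unit[simplified])
lemma copy_cocomm: "copy ;; swap 1 1 = copy"
  by transfer (auto intro: beq.copy_comm[simplified])
lemma add_assoc: "(add \<otimes>\<^sub>B ident 1) ;; add = (ident 1 \<otimes>\<^sub>B add) ;; add"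
  by transfer (auto intro: beq.add_assoc[simplified])
lemma add_unit_left: "(zero \<otimes>\<^sub>B ident 1) ;; add = ident 1"
  by transfer (auto intro: beq.add_unit[simplified])
lemma add_comm: "swap 1 1 ;; add = add"
  by transfer (auto intro: beq.add_comm[simplified])
lemma add_copy:
  "add ;; copy = (copy \<otimes>\<^sub>B copy) ;; (ident 1 \<otimes>\<^sub>B swap 1 1 \<otimes>\<^sub>B ident 1) ;; (add \<otimes>\<^sub>B add)"
  by transfer (auto intro: beq.add_copy[simplified])
lemma add_del: "add ;; del = del \<otimes>\<^sub>B del"
  by transfer (auto intro: beq.add_del)
lemma zero_copy: "zero ;; copy = zero \<otimes>\<^sub>B zero"
  by transfer (auto intro: beq.zero_copy)
lemma zero_del: "zero ;; del = ident 0"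
  by transfer (auto intro: beq.zero_del)

lemma M_simps [simp]:
  "M copy = mat 2 1 (\<lambda>_. 1)" "M del = 0\<^sub>m 0 1" "M add = mat 1 2 (\<lambda>_. 1)" "M zero = 0\<^sub>m 1 0"
  "M (ident n) = 1\<^sub>m n" "M (swap n m) = swap_mat n m"
  "M (f \<otimes>\<^sub>B g) = dsum (M f) (M g)"
  by (transfer; simp)+

lemma M_seq [simp]: "bcod f = bdom g \<Longrightarrow> M (f ;; g) = M g * M f"
  by transfer simp

lemma M_carrier [simp, intro]: "M f \<in> carrier_mat (bcod f) (bdom f)"
  by transfer (simp add: tmat_carrier)

lemma dim_M [simp]: "dim_row (M f) = bcod f" "dim_col (M f) = bdom f"
  using M_carrier[of f] unfolding carrier_mat_def by auto

text \<open>By the hexagon law \<open>swap n 0\<close> is idempotent, and it is invertible, hence it is an identity.\<close>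

lemma swap_0_right [simp]: "swap n 0 = ident n"
proof -
  have idem: "swap n 0 = swap n 0 ;; swap n 0"
    using swap_right_add[of n 0 0] by simp
  have "swap n 0 = swap n 0 ;; (swap n 0 ;; swap 0 n)"
    by (simp add: swap_swap)
  also have "\<dots> = (swap n 0 ;; swap n 0) ;; swap 0 n"
    by (simp add: seq_assoc)
  also have "\<dots> = ident n"
    by (simp add: idem[symmetric] swap_swap)
  finally show ?thesis .
qed

lemma swap_0_left [simp]: "swap 0 n = ident n"
  using swap_swap[of n 0] by simp

text \<open>This is the second hexagon law: its right-hand side is, by the first law, an inverse of
  \<open>swap k (n + m)\<close>, and inverses are unique.\<close>

lemma swap_left_add:
  "swap (n + m) k = (ident n \<otimes>\<^sub>B swap m k) ;; (swap n k \<otimes>\<^sub>B ident m)"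
    (is "_ = ?X")
proof -
  have "swap k (n + m) ;; ?X = (swap k n \<otimes>\<^sub>B ident m) ;; (ident n \<otimes>\<^sub>B (swap k m ;; swap m k)) ;; (swap n k \<otimes>\<^sub>B ident m)"
    by (simp add: swap_right_add seq_assoc whisker_left)
  also have "\<dots> = (swap k n ;; swap n k) \<otimes>\<^sub>B ident m"
    by (simp add: swap_swap tensor_ident interchange flip: add.assoc)
  also have "\<dots> = ident (k + n + m)"
    by (simp add: swap_swap tensor_ident)
  finally have inv: "swap k (n + m) ;; ?X = ident (k + n + m)" .
  have "swap (n + m) k = swap (n + m) k ;; swap k (n + m) ;; ?X"
    unfolding inv by simp
  also have "\<dots> = (swap (n + m) k ;; swap k (n + m)) ;; ?X"
    by (simp add: seq_assoc)
  also have "\<dots> = ?X"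
    by (simp add: swap_swap)
  finally show ?thesis .
qed

text \<open>Inductions over morphisms go through this set. Among the symmetries it keeps only \<open>swap 1 1\<close>,
  for which an inductive claim can be checked by hand; the hexagon laws give the others.\<close>

inductive_set generated :: "bialg set" where
  copy: "copy \<in> generated"
| del: "del \<in> generated"
| add: "add \<in> generated"
| zero: "zero \<in> generated"
| swap_11: "swap 1 1 \<in> generated"
| ident: "ident n \<in> generated"
| tensor: "f \<in> generated \<Longrightarrow> g \<in> generated \<Longrightarrow> f \<otimes>\<^sub>B g \<in> generated"
| seq: "f \<in> generated \<Longrightarrow> g \<in> generated \<Longrightarrow> bcod f = bdom g \<Longrightarrow> f ;; g \<in> generated"

lemma swap_generated: "swap n m \<in> generated"
proof -
  have one: "swap n 1 \<in> generated" for n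
  proof (induction n)
    case (Suc n)
    have "(ident 1 \<otimes>\<^sub>B swap n 1) ;; (swap 1 1 \<otimes>\<^sub>B ident n) \<in> generated"
      by (rule generated.seq) (simp_all add: generated.intros Suc)
    then show ?case by (simp only: swap_left_add[symmetric] plus_1_eq_Suc)
  qed (simp add: generated.ident)
  show ?thesis
  proof (induction m)
    case (Suc m)
    have "(swap n m \<otimes>\<^sub>B ident 1) ;; (ident m \<otimes>\<^sub>B swap n 1) \<in> generated"
      by (rule generated.seq) (simp_all add: generated.intros Suc one)
    then show ?case by (simp only: swap_right_add[symmetric] Suc_eq_plus1)
  qed (simp add: generated.ident)
qed

lemma all_generated: "f \<in> generated"
proof -
  have rep: "wf_bterm s \<Longrightarrow> abs_bialg s \<in> generated" for s
  proof (induction s)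
    case (Swap n m)
    then show ?case using swap_generated by (simp add: swap.abs_eq)
  next
    case (Seq s t)
    then have "abs_bialg (Seq s t) = abs_bialg s ;; abs_bialg t" "bcod (abs_bialg s) = bdom (abs_bialg t)"
      by (simp_all add: seq.abs_eq bcod.abs_eq bdom.abs_eq beq_refl_iff)
    with Seq show ?case by (auto intro: generated.seq)
  next
    case (Par s t)
    then have "abs_bialg (Par s t) = abs_bialg s \<otimes>\<^sub>B abs_bialg t" 
      by (simp_all add: tensor.abs_eq beq_refl_iff)
    with Par show ?case by (auto intro: generated.tensor)
  qed (auto simp flip: copy.abs_eq del.abs_eq add.abs_eq zero.abs_eq ident.abs_eq swap.abs_eq intro: generated.intros)
  show ?thesis
    using rep[of "rep_bialg f"] 
    by (metis Quotient3_bialg Quotient3_def beq_refl_iff)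
qed

section \<open>Morphisms out of the object 1\<close>

lemma copy_counit_right: "copy ;; (ident 1 \<otimes>\<^sub>B del) = ident 1"
proof -
  have "copy ;; (ident 1 \<otimes>\<^sub>B del) = (copy ;; swap 1 1) ;; (ident 1 \<otimes>\<^sub>B del)"
    by (simp add: copy_cocomm)
  also have "\<dots> = copy ;; (del \<otimes>\<^sub>B ident 1)"
    using swap_natural[of del 0 "ident 1" 1] by (simp add: seq_assoc)
  finally show ?thesis by (simp add: copy_counit_left)
qed

lemma add_unit_right: "(ident 1 \<otimes>\<^sub>B zero) ;; add = ident 1"
proof -
  have "(ident 1 \<otimes>\<^sub>B zero) ;; add = (ident 1 \<otimes>\<^sub>B zero) ;; swap 1 1 ;; add"
    by (simp add: add_comm)
  also have "\<dots> = ((ident 1 \<otimes>\<^sub>B zero) ;; swap 1 1) ;; add"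
    by (simp add: seq_assoc)
  also have "\<dots> = (zero \<otimes>\<^sub>B ident 1) ;; add"
    by (subst swap_natural) simp_all
  finally show ?thesis by (simp add: add_unit_left)
qed

text \<open>Of the four wires that leave a twice iterated copy, the two middle ones can be taken, by
  coassociativity, to come from one copy, and that copy is cocommutative.\<close>

lemma copy_copy_middle_swap:
  "copy ;; (copy \<otimes>\<^sub>B copy) ;; (ident 1 \<otimes>\<^sub>B swap 1 1 \<otimes>\<^sub>B ident 1) = copy ;; (copy \<otimes>\<^sub>B copy)"
proof -
  have "copy ;; (copy \<otimes>\<^sub>B copy) = (copy ;; (copy \<otimes>\<^sub>B ident 1)) ;; (ident 2 \<otimes>\<^sub>B copy)"
    by (simp add: seq_assoc interchange)
  also have "\<dots> = copy ;; (ident 1 \<otimes>\<^sub>B copy) ;; (ident 1 \<otimes>\<^sub>B ident 1 \<otimes>\<^sub>B copy)"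
    by (simp add: copy_coassoc seq_assoc tensor_ident flip: tensor_assoc)
  also have "\<dots> = copy ;; (ident 1 \<otimes>\<^sub>B (copy ;; (copy \<otimes>\<^sub>B ident 1)))"
    by (simp add: interchange copy_coassoc)
  finally have nested: "copy ;; (copy \<otimes>\<^sub>B copy) = copy ;; (ident 1 \<otimes>\<^sub>B (copy ;; (copy \<otimes>\<^sub>B ident 1)))" .
  have "copy ;; (copy \<otimes>\<^sub>B copy) ;; (ident 1 \<otimes>\<^sub>B swap 1 1 \<otimes>\<^sub>B ident 1)
      = (copy ;; (copy \<otimes>\<^sub>B copy)) ;; (ident 1 \<otimes>\<^sub>B swap 1 1 \<otimes>\<^sub>B ident 1)"
    by (simp add: seq_assoc)
  also have "\<dots> = copy ;; (ident 1 \<otimes>\<^sub>B (copy ;; (copy \<otimes>\<^sub>B ident 1) ;; (swap 1 1 \<otimes>\<^sub>B ident 1)))"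
    by (simp add: nested seq_assoc interchange)
  also have "\<dots> = copy ;; (copy \<otimes>\<^sub>B copy)"
    by (simp add: nested interchange copy_cocomm)
  finally show ?thesis .
qed

text \<open>Multiplication by \<open>k\<close>, that is the \<open>k\<close>-fold convolution power of the identity of \<open>1\<close>; the
  convolution unit is \<open>del ;; zero\<close>.\<close>

primrec scalar :: "nat \<Rightarrow> bialg" where
  "scalar 0 = del ;; zero"
| "scalar (Suc k) = copy ;; (ident 1 \<otimes>\<^sub>B scalar k) ;; add"

lemma bdom_bcod_scalar [simp]: "bdom (scalar k) = 1" "bcod (scalar k) = 1"
  by (induction k) simp_all

lemma scalar_1: "scalar 1 = ident 1"
proof -
  have "scalar 1 = copy ;; (ident 1 \<otimes>\<^sub>B del) ;; (ident 1 \<otimes>\<^sub>B zero) ;; add"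
    by (simp add: One_nat_def whisker_left seq_assoc)
  also have "\<dots> = ident 1"
    by (simp add: add_unit_right copy_counit_right)
  finally show ?thesis .
qed

lemma scalar_del: "scalar k ;; del = del"
proof (induction k)
  case 0
  then show ?case by (simp add: seq_assoc zero_del)
next
  case (Suc k)
  have "scalar (Suc k) ;; del = copy ;; (ident 1 \<otimes>\<^sub>B scalar k) ;; (del \<otimes>\<^sub>B del)"
    by (simp add: seq_assoc add_del)
  also have "\<dots> = copy ;; (del \<otimes>\<^sub>B del)"
    by (simp add: interchange Suc)
  also have "\<dots> = copy ;; (del \<otimes>\<^sub>B ident 1) ;; (ident 0 \<otimes>\<^sub>B del)"
    by (subst interchange) simp_all
  also have "\<dots> = (copy ;; (del \<otimes>\<^sub>B ident 1)) ;; del"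
    by (simp add: seq_assoc)
  finally show ?case by (simp add: copy_counit_left)
qed

text \<open>Naturality of a symmetry that acts on the two middle factors of a fourfold tensor product. In a
  right-nested product the middle pair is not a subterm.\<close>

lemma swap_middle_natural:
  assumes "bcod f = m" "bcod g = m'" "bcod a = k" "bcod b = l"
  shows "(a \<otimes>\<^sub>B f \<otimes>\<^sub>B g \<otimes>\<^sub>B b) ;; (ident k \<otimes>\<^sub>B swap m m' \<otimes>\<^sub>B ident l)
       = (ident (bdom a) \<otimes>\<^sub>B swap (bdom f) (bdom g) \<otimes>\<^sub>B ident (bdom b)) ;; (a \<otimes>\<^sub>B g \<otimes>\<^sub>B f \<otimes>\<^sub>B b)"
proof -
  have "(a \<otimes>\<^sub>B f \<otimes>\<^sub>B g \<otimes>\<^sub>B b) ;; (ident k \<otimes>\<^sub>B swap m m' \<otimes>\<^sub>B ident l)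
    = a \<otimes>\<^sub>B ((f \<otimes>\<^sub>B g) ;; swap m m') \<otimes>\<^sub>B b"
    using assms by (simp add: interchange tensor_assoc[symmetric, of f g])
  also have "(f \<otimes>\<^sub>B g) ;; swap m m' = swap (bdom f) (bdom g) ;; (g \<otimes>\<^sub>B f)"
    using swap_natural[of f m g m'] assms by simp
  also have "a \<otimes>\<^sub>B \<dots> \<otimes>\<^sub>B b = (ident (bdom a) \<otimes>\<^sub>B swap (bdom f) (bdom g) \<otimes>\<^sub>B ident (bdom b)) ;; (a \<otimes>\<^sub>B g \<otimes>\<^sub>B f \<otimes>\<^sub>B b)"
    using assms by (simp add: interchange tensor_assoc[symmetric, of g f])
  finally show ?thesis .
qed

text \<open>Scalars are comonoid morphisms. In the inductive step the bialgebra law moves the copy above the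
  addition; this creates a middle swap, which slides through the scalar and is absorbed by the two
  copies above it.\<close>

lemma scalar_copy: "scalar k ;; copy = copy ;; (scalar k \<otimes>\<^sub>B scalar k)"
proof (induction k)
  case 0
  have "del ;; zero ;; copy = del ;; (zero \<otimes>\<^sub>B zero)"
    by (simp add: zero_copy)
  also have "\<dots> = (copy ;; (del \<otimes>\<^sub>B ident 1)) ;; del ;; (zero \<otimes>\<^sub>B zero)"
    by (simp add: copy_counit_left)
  also have "\<dots> = copy ;; ((del \<otimes>\<^sub>B ident 1) ;; (ident 0 \<otimes>\<^sub>B del)) ;; (zero \<otimes>\<^sub>B zero)"
    by (simp add: seq_assoc)
  also have "\<dots> = copy ;; ((del ;; zero) \<otimes>\<^sub>B (del ;; zero))"
    by (subst interchange) (simp_all add: interchange)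
  finally show ?case by (simp add: seq_assoc)
next
  case (Suc k)
  let ?s = "scalar k"
  have "scalar (Suc k) ;; copy
      = copy ;; ((ident 1 \<otimes>\<^sub>B ?s) ;; (copy \<otimes>\<^sub>B copy)) ;; (ident 1 \<otimes>\<^sub>B swap 1 1 \<otimes>\<^sub>B ident 1) ;; (add \<otimes>\<^sub>B add)"
    by (simp add: seq_assoc add_copy)
  also have "(ident 1 \<otimes>\<^sub>B ?s) ;; (copy \<otimes>\<^sub>B copy)
      = (copy \<otimes>\<^sub>B copy) ;; (ident 2 \<otimes>\<^sub>B ?s \<otimes>\<^sub>B ?s)"
    by (simp add: interchange Suc)
  also have "copy ;; \<dots> ;; (ident 1 \<otimes>\<^sub>B swap 1 1 \<otimes>\<^sub>B ident 1) ;; (add \<otimes>\<^sub>B add)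
      = copy ;; (copy \<otimes>\<^sub>B copy) ;; ((ident 1 \<otimes>\<^sub>B ident 1 \<otimes>\<^sub>B ?s \<otimes>\<^sub>B ?s) ;; (ident 1 \<otimes>\<^sub>B swap 1 1 \<otimes>\<^sub>B ident 1)) ;; (add \<otimes>\<^sub>B add)"
    by (simp add: seq_assoc tensor_ident flip: tensor_assoc)
  also have "(ident 1 \<otimes>\<^sub>B ident 1 \<otimes>\<^sub>B ?s \<otimes>\<^sub>B ?s) ;; (ident 1 \<otimes>\<^sub>B swap 1 1 \<otimes>\<^sub>B ident 1)
     = (ident 1 \<otimes>\<^sub>B swap 1 1 \<otimes>\<^sub>B ident 1) ;; (ident 1 \<otimes>\<^sub>B ?s \<otimes>\<^sub>B ident 1 \<otimes>\<^sub>B ?s)"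
    by (subst swap_middle_natural) simp_all
  also have "copy ;; (copy \<otimes>\<^sub>B copy) ;; \<dots> ;; (add \<otimes>\<^sub>B add)
     = (copy ;; (copy \<otimes>\<^sub>B copy) ;; (ident 1 \<otimes>\<^sub>B swap 1 1 \<otimes>\<^sub>B ident 1)) ;; (ident 1 \<otimes>\<^sub>B ?s \<otimes>\<^sub>B ident 1 \<otimes>\<^sub>B ?s) ;; (add \<otimes>\<^sub>B add)"
    by (simp add: seq_assoc)
  also have "\<dots> = copy ;; (copy \<otimes>\<^sub>B copy) ;; ((ident 1 \<otimes>\<^sub>B ?s) \<otimes>\<^sub>B (ident 1 \<otimes>\<^sub>B ?s)) ;; (add \<otimes>\<^sub>B add)"
    unfolding copy_copy_middle_swap by (simp add: seq_assoc tensor_assoc)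
  also have "\<dots> = copy ;; (scalar (Suc k) \<otimes>\<^sub>B scalar (Suc k))"
    by (simp add: interchange)
  finally show ?case .
qed

lemma scalar_add: "copy ;; (scalar x \<otimes>\<^sub>B scalar y) ;; add = scalar (x + y)"
proof (induction x)
  case 0
  have "copy ;; (scalar 0 \<otimes>\<^sub>B scalar y) ;; add
     = copy ;; ((del \<otimes>\<^sub>B ident 1) ;; (ident 0 \<otimes>\<^sub>B scalar y) ;; (zero \<otimes>\<^sub>B ident 1)) ;; add"
    by (simp only: interchange bdom_bcod_generators bdom_bcod_tensor bdom_bcod_seq bdom_bcod_scalar)
      (simp add: seq_assoc)
  also have "\<dots> = (copy ;; (del \<otimes>\<^sub>B ident 1)) ;; scalar y ;; ((zero \<otimes>\<^sub>B ident 1) ;; add)"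
    by (simp add: seq_assoc)
  finally show ?case by (simp add: copy_counit_left add_unit_left)
next
  case (Suc x)
  have "scalar (Suc x) \<otimes>\<^sub>B scalar y
     = (copy \<otimes>\<^sub>B ident 1) ;; ((ident 1 \<otimes>\<^sub>B scalar x) \<otimes>\<^sub>B scalar y) ;; (add \<otimes>\<^sub>B ident 1)"
    by (simp add: interchange)
  then have "copy ;; (scalar (Suc x) \<otimes>\<^sub>B scalar y) ;; add
     = (copy ;; (copy \<otimes>\<^sub>B ident 1)) ;; ((ident 1 \<otimes>\<^sub>B scalar x) \<otimes>\<^sub>B scalar y) ;; ((add \<otimes>\<^sub>B ident 1) ;; add)"
    by (simp add: seq_assoc)
  also have "\<dots> = copy ;; ((ident 1 \<otimes>\<^sub>B copy) ;; (ident 1 \<otimes>\<^sub>B scalar x \<otimes>\<^sub>B scalar y) ;; (ident 1 \<otimes>\<^sub>B add)) ;; add"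
    by (simp add: add_assoc copy_coassoc seq_assoc tensor_assoc)
  also have "\<dots> = copy ;; (ident 1 \<otimes>\<^sub>B (copy ;; (scalar x \<otimes>\<^sub>B scalar y) ;; add)) ;; add"
    by (simp add: interchange)
  finally show ?case by (simp add: Suc)
qed

text \<open>The normal form of a morphism \<open>1 \<rightarrow> m\<close>: a column vector.\<close>

primrec column :: "nat list \<Rightarrow> bialg" where
  "column [] = del"
| "column (x # xs) = copy ;; (scalar x \<otimes>\<^sub>B column xs)"

lemma bdom_bcod_column [simp]: "bdom (column xs) = 1" "bcod (column xs) = length xs"
  by (induction xs) simp_all

lemma column_append: "column (xs @ ys) = copy ;; (column xs \<otimes>\<^sub>B column ys)"
proof (induction xs)
  case Nil
  have "copy ;; (del \<otimes>\<^sub>B column ys) = copy ;; (del \<otimes>\<^sub>B ident 1) ;; (ident 0 \<otimes>\<^sub>B column ys)"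
    by (simp only: interchange bdom_bcod_generators bdom_bcod_column) simp
  also have "\<dots> = (copy ;; (del \<otimes>\<^sub>B ident 1)) ;; column ys"
    by (simp add: seq_assoc)
  finally show ?case by (simp add: copy_counit_left)
next
  case (Cons x xs)
  have "column ((x # xs) @ ys) = copy ;; ((ident 1 \<otimes>\<^sub>B copy) ;; (scalar x \<otimes>\<^sub>B column xs \<otimes>\<^sub>B column ys))"
    by (simp add: Cons interchange)
  also have "\<dots> = (copy ;; (copy \<otimes>\<^sub>B ident 1)) ;; (scalar x \<otimes>\<^sub>B column xs \<otimes>\<^sub>B column ys)"
    by (simp add: copy_coassoc seq_assoc)
  also have "\<dots> = copy ;; ((copy ;; (scalar x \<otimes>\<^sub>B column xs)) \<otimes>\<^sub>B column ys)"
    by (simp add: seq_assoc interchange flip: tensor_assoc)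
  finally show ?case by simp
qed

lemma column_single: "column [x] = scalar x"
proof -
  have "column [x] = copy ;; (ident 1 \<otimes>\<^sub>B del) ;; (scalar x \<otimes>\<^sub>B ident 0)"
    by (simp only: interchange bdom_bcod_generators bdom_bcod_scalar) simp
  also have "\<dots> = (copy ;; (ident 1 \<otimes>\<^sub>B del)) ;; scalar x"
    by (simp add: seq_assoc)
  finally show ?thesis by (simp add: copy_counit_right)
qed

lemma column_pair: "column [x, y] = copy ;; (scalar x \<otimes>\<^sub>B scalar y)"
  using column.simps(2)[of x "[y]"] by (simp only: column_single)

text \<open>A morphism acts on column vectors through its matrix. The proof is an induction over the
  generators; the generating cases come down to the bialgebra laws, extended to scalars by
  the lemmas above. This is half of the completeness of matrices: \<open>M f\<close> determines what \<open>f\<close> does to columns.\<close>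

lemma column_seq:
  "v \<in> carrier_vec (bdom f) \<Longrightarrow> column (list_of_vec v) ;; f = column (list_of_vec (M f *\<^sub>v v))"
proof -
  have "f \<in> generated" by (rule all_generated)
  then show "v \<in> carrier_vec (bdom f) \<Longrightarrow> column (list_of_vec v) ;; f = column (list_of_vec (M f *\<^sub>v v))"
  proof (induction arbitrary: v rule: generated.induct)
    case (tensor f g)
    obtain u w where v: "v = u @\<^sub>v w" and u: "u \<in> carrier_vec (bdom f)" and w: "w \<in> carrier_vec (bdom g)"
      using tensor.prems vec_first_last_append[of v "bdom f" "bdom g"] 
      by (metis bdom_bcod_tensor(1) vec_first_carrier vec_last_carrier)
    have mv: "dsum (M f) (M g) *\<^sub>v (u @\<^sub>v w) = (M f *\<^sub>v u) @\<^sub>v (M g *\<^sub>v w)"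
    proof -
      have "four_block_mat (M f) (0\<^sub>m (bcod f) (bdom g)) (0\<^sub>m (bcod g) (bdom f)) (M g) *\<^sub>v (u @\<^sub>v w)
          = (M f *\<^sub>v u + 0\<^sub>m (bcod f) (bdom g) *\<^sub>v w) @\<^sub>v (0\<^sub>m (bcod g) (bdom f) *\<^sub>v u + M g *\<^sub>v w)"
        by (rule four_block_mat_mult_vec[OF M_carrier zero_carrier_mat zero_carrier_mat M_carrier u w])
      moreover have "0\<^sub>m (bcod f) (bdom g) *\<^sub>v w = 0\<^sub>v (bcod f)" "0\<^sub>m (bcod g) (bdom f) *\<^sub>v u = 0\<^sub>v (bcod g)"
        using u w by (auto intro!: eq_vecI)
      moreover have "M f *\<^sub>v u \<in> carrier_vec (bcod f)" "M g *\<^sub>v w \<in> carrier_vec (bcod g)"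
        by (auto intro: carrier_vecI)
      ultimately show ?thesis
        by (simp add: dsum_def)
    qed
    show ?case using u w
      by (simp add: v mv column_append seq_assoc interchange tensor.IH)
  next
    case (seq f g)
    have "column (list_of_vec v) ;; f ;; g = (column (list_of_vec v) ;; f) ;; g"
      using seq.hyps seq.prems by (simp add: seq_assoc)
    also have "\<dots> = column (list_of_vec (M g *\<^sub>v (M f *\<^sub>v v)))"
      using seq carrier_vecI[of "M f *\<^sub>v v" "bdom g"] by simp
    also have "M g *\<^sub>v (M f *\<^sub>v v) = M g * M f *\<^sub>v v"
      using assoc_mult_mat_vec[of "M g" "bcod g" "bdom g" "M f" "bdom f" v] seq.hyps seq.prems
      by (simp add: carrier_matI)
    finally show ?case using seq.hyps by simp
  next
    case copy
    then have "list_of_vec v = [v $ 0]" "list_of_vec (M copy *\<^sub>v v) = [v $ 0, v $ 0]"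
      by (simp_all add: list_of_vec_map scalar_prod_def numeral_2_eq_2 One_nat_def)
    then show ?case
      by (simp add: column_single column_pair scalar_copy del: column.simps M_simps)
  next
    case del
    then have "list_of_vec v = [v $ 0]" "list_of_vec (M del *\<^sub>v v) = []"
      by (simp_all add: list_of_vec_map One_nat_def)
    then show ?case
      by (simp add: column_single scalar_del del: column.simps(2) M_simps)
  next
    case add
    then have "list_of_vec v = [v $ 0, v $ 1]" "list_of_vec (M add *\<^sub>v v) = [v $ 0 + v $ 1]"
      by (simp_all add: list_of_vec_map scalar_prod_def numeral_2_eq_2 One_nat_def)
    then show ?case
      by (simp add: column_single column_pair seq_assoc scalar_add del: column.simps M_simps)
  next
    case zero
    then have "list_of_vec v = []" "list_of_vec (M zero *\<^sub>v v) = [0]"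
      by (simp_all add: list_of_vec_map scalar_prod_def One_nat_def)
    then show ?case
      by (simp add: column_single del: column.simps(2) M_simps)
  next
    case swap_11
    then have "list_of_vec v = [v $ 0, v $ 1]"
      and "list_of_vec (M (swap 1 1) *\<^sub>v v) = [v $ 1, v $ 0]"
      by (simp_all add: list_of_vec_map scalar_prod_def numeral_2_eq_2 One_nat_def swap_mat_def)
    moreover have "column [x, y] ;; swap 1 1 = column [y, x]" for x y
    proof -
      have "column [x, y] ;; swap 1 1 = (copy ;; swap 1 1) ;; (scalar y \<otimes>\<^sub>B scalar x)"
        using swap_natural[of "scalar x" 1 "scalar y" 1]
        by (simp add: column_pair seq_assoc del: column.simps)
      then show ?thesis
        by (simp add: column_pair copy_cocomm del: column.simps)
    qed
    ultimately show ?case by (simp del: column.simps M_simps)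
  next
    case ident
    then show ?case by simp
  qed
qed

section \<open>Addition on all objects and faithfulness of the matrix semantics\<close>

lemma tensor_ident_left: "ident n \<otimes>\<^sub>B ident m \<otimes>\<^sub>B f = ident (n + m) \<otimes>\<^sub>B f"
  by (simp add: tensor_ident flip: tensor_assoc)

text \<open>Mirror image of \<open>copy_copy_middle_swap\<close>: it says that addition is itself a homomorphism for
  addition, which is the case of \<open>add\<close> in the naturality proof.\<close>

lemma add_add_middle_swap:
  "(ident 1 \<otimes>\<^sub>B swap 1 1 \<otimes>\<^sub>B ident 1) ;; (add \<otimes>\<^sub>B add) ;; add = (add \<otimes>\<^sub>B add) ;; add"
proof -
  have "(add \<otimes>\<^sub>B add) ;; add = (ident 2 \<otimes>\<^sub>B add) ;; (add \<otimes>\<^sub>B ident 1) ;; add"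
    by (simp add: interchange flip: seq_assoc)
  also have "\<dots> = (ident 1 \<otimes>\<^sub>B ident 1 \<otimes>\<^sub>B add) ;; (ident 1 \<otimes>\<^sub>B add) ;; add"
    by (simp add: add_assoc tensor_ident_left)
  also have "\<dots> = (ident 1 \<otimes>\<^sub>B ((add \<otimes>\<^sub>B ident 1) ;; add)) ;; add"
    by (simp add: add_assoc interchange flip: seq_assoc)
  finally have nested: "(add \<otimes>\<^sub>B add) ;; add = (ident 1 \<otimes>\<^sub>B ((add \<otimes>\<^sub>B ident 1) ;; add)) ;; add" .
  have "(ident 1 \<otimes>\<^sub>B swap 1 1 \<otimes>\<^sub>B ident 1) ;; (add \<otimes>\<^sub>B add) ;; add
      = (ident 1 \<otimes>\<^sub>B ((swap 1 1 \<otimes>\<^sub>B ident 1) ;; (add \<otimes>\<^sub>B ident 1) ;; add)) ;; add"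
    by (simp add: nested interchange flip: seq_assoc)
  also have "(swap 1 1 \<otimes>\<^sub>B ident 1) ;; (add \<otimes>\<^sub>B ident 1) ;; add = (add \<otimes>\<^sub>B ident 1) ;; add"
    by (simp add: interchange add_comm flip: seq_assoc)
  finally show ?thesis by (simp add: nested)
qed

text \<open>Componentwise addition \<open>n + n \<rightarrow> n\<close>; the symmetry brings the two first components together.\<close>

primrec adder :: "nat \<Rightarrow> bialg" where
  "adder 0 = ident 0"
| "adder (Suc n) = (ident 1 \<otimes>\<^sub>B swap n 1 \<otimes>\<^sub>B ident n) ;; (add \<otimes>\<^sub>B adder n)"

lemma bdom_bcod_adder [simp]: "bdom (adder n) = n + n" "bcod (adder n) = n"
  by (induction n) simp_all

text \<open>Componentwise addition is monoidal. Both sides agree up to the order in which wires are permuted,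
  and the two permutations are composed of the same three layers \<open>A\<close>, \<open>B\<close> (or \<open>D\<close>) and \<open>C\<close>, of which
  \<open>B\<close> and \<open>C\<close> act on disjoint wires and commute.\<close>

lemma adder_add:
  "adder (a + b) = (ident a \<otimes>\<^sub>B swap b a \<otimes>\<^sub>B ident b) ;; (adder a \<otimes>\<^sub>B adder b)"
proof (induction a)
  case 0
  then show ?case by (simp add: tensor_ident)
next
  case (Suc a)
  define A where "A = ident a \<otimes>\<^sub>B swap b 1 \<otimes>\<^sub>B ident (a + b)"
  define B where "B = swap a 1 \<otimes>\<^sub>B ident (b + a + b)"
  define C where "C = ident (1 + a) \<otimes>\<^sub>B swap b a \<otimes>\<^sub>B ident b"
  note ABC = A_def B_def C_def
  let ?P = "add \<otimes>\<^sub>B adder a \<otimes>\<^sub>B adder b"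
  have 1: "swap (a + b) 1 \<otimes>\<^sub>B ident (a + b) = A ;; B"
    by (simp add: swap_left_add whisker_right ABC tensor_assoc tensor_ident tensor_ident_left ac_simps)
  have 2: "ident a \<otimes>\<^sub>B swap b (1 + a) \<otimes>\<^sub>B ident b = A ;; C"
    by (simp add: swap_right_add whisker_right whisker_left ABC tensor_assoc tensor_ident tensor_ident_left ac_simps)
  have "B ;; C = swap a 1 \<otimes>\<^sub>B swap b a \<otimes>\<^sub>B ident b"
    by (simp add: ABC interchange)
  also have "\<dots> = C ;; (swap a 1 \<otimes>\<^sub>B ident (a + b + b))"
    by (simp add: ABC interchange)
  finally have 3: "B ;; C = C ;; (swap a 1 \<otimes>\<^sub>B ident (a + b + b))" .
  define D where "D = swap a 1 \<otimes>\<^sub>B ident (a + b + b)"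
  have types: "bdom A = 1 + a + b + a + b" "bcod A = bdom B" "bcod B = bdom C" "bcod A = bdom C" "bcod C = bdom D"
    "bcod D = bcod C" "bdom ?P = 1 + bcod D"
    by (simp_all add: ABC D_def)
  have tail: "adder (Suc a) \<otimes>\<^sub>B adder b = (ident 1 \<otimes>\<^sub>B D) ;; ?P"
  proof -
    have "adder (Suc a) \<otimes>\<^sub>B adder b
      = ((ident 1 \<otimes>\<^sub>B swap a 1 \<otimes>\<^sub>B ident a) \<otimes>\<^sub>B ident (b + b)) ;; ((add \<otimes>\<^sub>B adder a) \<otimes>\<^sub>B adder b)"
      by (subst interchange) simp_all
    then show ?thesis by (simp add: D_def tensor_assoc tensor_ident add.assoc)
  qed
  have "add \<otimes>\<^sub>B adder (a + b) = (ident 2 \<otimes>\<^sub>B ident a \<otimes>\<^sub>B swap b a \<otimes>\<^sub>B ident b) ;; ?P"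
    by (simp add: Suc interchange)
  also have "ident 2 \<otimes>\<^sub>B ident a \<otimes>\<^sub>B swap b a \<otimes>\<^sub>B ident b = ident 1 \<otimes>\<^sub>B C"
    by (simp add: C_def tensor_ident_left flip: add.assoc)
  finally have head: "add \<otimes>\<^sub>B adder (a + b) = (ident 1 \<otimes>\<^sub>B C) ;; ?P" .
  have "adder (Suc a + b) = (ident 1 \<otimes>\<^sub>B (A ;; B)) ;; (ident 1 \<otimes>\<^sub>B C) ;; ?P"
    by (simp add: head flip: 1)
  also have "\<dots> = (ident 1 \<otimes>\<^sub>B (A ;; (B ;; C))) ;; ?P"
    using types by (simp add: whisker_left seq_assoc)
  also have "\<dots> = (ident 1 \<otimes>\<^sub>B (A ;; C)) ;; (ident 1 \<otimes>\<^sub>B D) ;; ?P"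
    unfolding 3 D_def[symmetric] using types by (simp add: whisker_left seq_assoc)
  also have "ident 1 \<otimes>\<^sub>B (A ;; C) = ident (Suc a) \<otimes>\<^sub>B swap b (Suc a) \<otimes>\<^sub>B ident b"
    by (simp add: tensor_ident_left Suc_eq_plus1_left flip: 2)
  finally show ?case by (simp only: tail)
qed

lemma adder_1: "adder 1 = add"
  by (simp add: One_nat_def numeral_2_eq_2 tensor_ident)

lemma adder_2: "adder 2 = (ident 1 \<otimes>\<^sub>B swap 1 1 \<otimes>\<^sub>B ident 1) ;; (add \<otimes>\<^sub>B add)"
  using adder_add[of 1 1] by (simp add: adder_1)

text \<open>Every morphism is additive. This makes the tensor product a coproduct, with injections given by
  zeros. For \<open>swap 1 1\<close> the claim is naturality of \<open>swap 2 2\<close> once that symmetry is written as a product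
  of adjacent swaps.\<close>

lemma adder_natural: "(f \<otimes>\<^sub>B f) ;; adder (bcod f) = adder (bdom f) ;; f"
proof -
  have "f \<in> generated" by (rule all_generated)
  then show ?thesis
  proof (induction rule: generated.induct)
    case copy
    show ?case by (simp add: adder_1 adder_2 add_copy)
  next
    case del
    show ?case by (simp add: adder_1 add_del)
  next
    case add
    show ?case by (simp add: adder_1 adder_2 seq_assoc add_add_middle_swap)
  next
    case zero
    have "zero \<otimes>\<^sub>B zero = (ident 0 \<otimes>\<^sub>B zero) ;; (zero \<otimes>\<^sub>B ident 1)"
      by (subst interchange) simp_all
    then show ?case by (simp add: adder_1 seq_assoc add_unit_left)
  next
    case swap_11
    let ?s = "swap 1 1" and ?i = "ident 1 \<otimes>\<^sub>B swap 1 1 \<otimes>\<^sub>B ident 1"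
    have swap_22: "swap 2 2 = ?i ;; (?s \<otimes>\<^sub>B ?s) ;; ?i"
    proof -
      have "swap 2 1 = (ident 1 \<otimes>\<^sub>B ?s) ;; (?s \<otimes>\<^sub>B ident 1)"
        using swap_left_add[of 1 1 1] by simp
      then have "swap 2 2 = ?i ;; ((?s \<otimes>\<^sub>B ident 2) ;; (ident 2 \<otimes>\<^sub>B ?s)) ;; ?i"
        using swap_right_add[of 2 1 1]
        by (simp add: whisker_left whisker_right seq_assoc tensor_assoc tensor_ident tensor_ident_left)
      then show ?thesis by (simp add: interchange)
    qed
    have "?i ;; ?i = ident 4"
      by (simp add: interchange swap_swap tensor_ident)
    then have "?i ;; swap 2 2 = (?s \<otimes>\<^sub>B ?s) ;; ?i"
      unfolding swap_22 by (simp flip: seq_assoc)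
    then have "(?s \<otimes>\<^sub>B ?s) ;; adder 2 = ?i ;; swap 2 2 ;; (add \<otimes>\<^sub>B add)"
      by (simp add: adder_2 flip: seq_assoc)
    \<comment> \<open>The symmetry \<open>swap 2 2\<close> slides through the two additions and becomes a single swap.\<close>
    also have "\<dots> = adder 2 ;; ?s"
      using swap_natural[of add 1 add 1] by (simp add: adder_2 seq_assoc)
    finally show ?case by simp
  next
    case (ident n)
    show ?case by (simp add: tensor_ident)
  next
    case (tensor f g)
    have "((f \<otimes>\<^sub>B g) \<otimes>\<^sub>B (f \<otimes>\<^sub>B g)) ;; adder (bcod (f \<otimes>\<^sub>B g))
      = ((f \<otimes>\<^sub>B g \<otimes>\<^sub>B f \<otimes>\<^sub>B g) ;; (ident (bcod f) \<otimes>\<^sub>B swap (bcod g) (bcod f) \<otimes>\<^sub>B ident (bcod g))) ;; (adder (bcod f) \<otimes>\<^sub>B adder (bcod g))"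
      by (simp add: adder_add seq_assoc tensor_assoc)
    also have "\<dots> = (ident (bdom f) \<otimes>\<^sub>B swap (bdom g) (bdom f) \<otimes>\<^sub>B ident (bdom g)) ;; ((f \<otimes>\<^sub>B f) \<otimes>\<^sub>B (g \<otimes>\<^sub>B g)) ;; (adder (bcod f) \<otimes>\<^sub>B adder (bcod g))"
      by (subst swap_middle_natural) (simp_all add: seq_assoc tensor_assoc)
    also have "\<dots> = adder (bdom (f \<otimes>\<^sub>B g)) ;; (f \<otimes>\<^sub>B g)"
      by (simp add: interchange tensor adder_add seq_assoc)
    finally show ?case .
  next
    case (seq f g)
    have "((f ;; g) \<otimes>\<^sub>B (f ;; g)) ;; adder (bcod (f ;; g)) = (f \<otimes>\<^sub>B f) ;; (g \<otimes>\<^sub>B g) ;; adder (bcod g)"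
      using seq.hyps by (simp add: interchange flip: seq_assoc)
    also have "\<dots> = (f \<otimes>\<^sub>B f) ;; adder (bcod f) ;; g"
      unfolding seq.IH(2) using seq.hyps by simp
    also have "\<dots> = ((f \<otimes>\<^sub>B f) ;; adder (bcod f)) ;; g"
      using seq.hyps by (simp add: seq_assoc del: adder.simps)
    also have "\<dots> = adder (bdom (f ;; g)) ;; f ;; g"
      unfolding seq.IH(1) using seq.hyps by (simp add: seq_assoc)
    finally show ?case .
  qed
qed

primrec zeros :: "nat \<Rightarrow> bialg" where
  "zeros 0 = ident 0"
| "zeros (Suc n) = zero \<otimes>\<^sub>B zeros n"

lemma bdom_bcod_zeros [simp]: "bdom (zeros n) = 0" "bcod (zeros n) = n"
  by (induction n) simp_all

lemma adder_zeros_left: "(zeros n \<otimes>\<^sub>B ident n) ;; adder n = ident n"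
proof (induction n)
  case (Suc n)
  have "zero \<otimes>\<^sub>B zeros n \<otimes>\<^sub>B ident (Suc n) = zero \<otimes>\<^sub>B zeros n \<otimes>\<^sub>B ident 1 \<otimes>\<^sub>B ident n"
    by (simp add: tensor_ident Suc_eq_plus1_left)
  then have "(zeros (Suc n) \<otimes>\<^sub>B ident (Suc n)) ;; adder (Suc n)
     = ((zero \<otimes>\<^sub>B zeros n \<otimes>\<^sub>B ident 1 \<otimes>\<^sub>B ident n) ;; (ident 1 \<otimes>\<^sub>B swap n 1 \<otimes>\<^sub>B ident n)) ;; (add \<otimes>\<^sub>B adder n)"
    by (simp add: seq_assoc tensor_assoc)
  also have "\<dots> = ((zero \<otimes>\<^sub>B ident 1) \<otimes>\<^sub>B (zeros n \<otimes>\<^sub>B ident n)) ;; (add \<otimes>\<^sub>B adder n)"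
    using swap_middle_natural[of "zeros n" n "ident 1" 1 zero 1 "ident n" n]
    by (simp add: tensor_ident tensor_assoc)
  also have "\<dots> = ident (Suc n)"
    by (simp add: interchange add_unit_left Suc tensor_ident Suc_eq_plus1_left)
  finally show ?case .
qed simp

lemma adder_injections: "(ident 1 \<otimes>\<^sub>B zeros n \<otimes>\<^sub>B zero \<otimes>\<^sub>B ident n) ;; adder (Suc n) = ident (Suc n)"
proof -
  have "(ident 1 \<otimes>\<^sub>B zeros n \<otimes>\<^sub>B zero \<otimes>\<^sub>B ident n) ;; adder (Suc n)
     = ((ident 1 \<otimes>\<^sub>B zeros n \<otimes>\<^sub>B zero \<otimes>\<^sub>B ident n) ;; (ident 1 \<otimes>\<^sub>B swap n 1 \<otimes>\<^sub>B ident n)) ;; (add \<otimes>\<^sub>B adder n)"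
    by (simp add: seq_assoc)
  also have "\<dots> = ((ident 1 \<otimes>\<^sub>B zero) \<otimes>\<^sub>B (zeros n \<otimes>\<^sub>B ident n)) ;; (add \<otimes>\<^sub>B adder n)"
    using swap_middle_natural[of "zeros n" n zero 1 "ident 1" 1 "ident n" n]
    by (simp add: tensor_ident tensor_assoc)
  also have "\<dots> = ident (Suc n)"
    by (simp add: interchange add_unit_right adder_zeros_left tensor_ident Suc_eq_plus1_left)
  finally show ?thesis .
qed

text \<open>Coproduct decomposition: a morphism is the sum of its restrictions to the first input and to the
  remaining ones.\<close>

lemma split_first_input:
  assumes "bdom f = Suc n"
  shows "f = (((ident 1 \<otimes>\<^sub>B zeros n) ;; f) \<otimes>\<^sub>B ((zero \<otimes>\<^sub>B ident n) ;; f)) ;; adder (bcod f)"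
proof -
  have "(((ident 1 \<otimes>\<^sub>B zeros n) ;; f) \<otimes>\<^sub>B ((zero \<otimes>\<^sub>B ident n) ;; f)) ;; adder (bcod f)
    = ((ident 1 \<otimes>\<^sub>B zeros n) \<otimes>\<^sub>B (zero \<otimes>\<^sub>B ident n)) ;; (f \<otimes>\<^sub>B f) ;; adder (bcod f)"
    using assms by (simp add: interchange flip: seq_assoc)
  also have "\<dots> = ((ident 1 \<otimes>\<^sub>B zeros n \<otimes>\<^sub>B zero \<otimes>\<^sub>B ident n) ;; adder (Suc n)) ;; f"
    using assms by (simp add: adder_natural seq_assoc tensor_assoc del: adder.simps)
  finally show ?thesis using assms by (simp only: adder_injections) simp
qed

text \<open>By the coproduct decomposition it suffices to compare the restrictions to single inputs. The
  premise is stated for all columns, and not only for unit vectors, because it then passes to the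
  restrictions at once: a column followed by an injection is again a column.\<close>

lemma eqI_columns:
  assumes "bdom f = bdom g" "bcod f = bcod g"
    and "\<And>v. v \<in> carrier_vec (bdom f) \<Longrightarrow> column (list_of_vec v) ;; f = column (list_of_vec v) ;; g"
  shows "f = g"
  using assms
proof (induction "bdom f" arbitrary: f g)
  case 0
  \<comment> \<open>For the object \<open>0\<close> the only column is \<open>del\<close>, which \<open>zero\<close> cancels.\<close>
  have "del ;; f = del ;; g" using 0(4)[of "0\<^sub>v 0"] 0(1) by simp
  then have "(zero ;; del) ;; f = (zero ;; del) ;; g"
    using 0 by (simp add: seq_assoc)
  then show ?case using 0 by (simp add: zero_del)
next
  case (Suc n)
  let ?i = "ident 1 \<otimes>\<^sub>B zeros n" and ?j = "zero \<otimes>\<^sub>B ident n"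
  have dims: "bdom f = Suc n" "bdom g = Suc n" using Suc by auto
  have cols: "column (list_of_vec v) ;; h ;; f = column (list_of_vec v) ;; h ;; g"
    if "bcod h = Suc n" "v \<in> carrier_vec (bdom h)" for h v
  proof -
    have "M h *\<^sub>v v \<in> carrier_vec (bdom f)"
      using that dims by (auto intro!: carrier_vecI)
    then have "(column (list_of_vec v) ;; h) ;; f = (column (list_of_vec v) ;; h) ;; g"
      using that Suc.prems(3) by (simp add: column_seq)
    then show ?thesis using that dims by (simp add: seq_assoc)
  qed
  have "?j ;; f = ?j ;; g"
    by (rule Suc.hyps(1)) (use dims Suc.prems cols[of ?j] in simp_all)
  moreover have "?i ;; f = ?i ;; g"
  proof -
    have "list_of_vec (vec 1 (\<lambda>_. 1)) = [1::nat]" by (simp add: One_nat_def)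
    then have "column [1] ;; ?i ;; f = column [1] ;; ?i ;; g" 
      using cols[of ?i "vec 1 (\<lambda>_. 1)"] by simp
    then show ?thesis using dims by (simp only: column_single scalar_1) simp
  qed
  ultimately show ?case
    using split_first_input[OF dims(1)] split_first_input[OF dims(2)] Suc.prems(2) by simp
qed

text \<open>Completeness of the bialgebra axioms for matrices over \<open>\<nat>\<close>.\<close>

theorem M_injective: "M f = M g \<Longrightarrow> f = g"
proof (rule eqI_columns)
  assume eq: "M f = M g"
  show "bdom f = bdom g" "bcod f = bcod g" using dim_M[of f] dim_M[of g] eq by auto
  then show "column (list_of_vec v) ;; f = column (list_of_vec v) ;; g" if "v \<in> carrier_vec (bdom f)" for v
    using that eq by (simp add: column_seq)
qed

section \<open>Matrices with narrow decompositions\<close>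

lemma dim_dsum [simp]: "dim_row (dsum A B) = dim_row A + dim_row B" "dim_col (dsum A B) = dim_col A + dim_col B"
  by (simp_all add: dsum_def)

lemma dsum_index: "i < dim_row A + dim_row B \<Longrightarrow> j < dim_col A + dim_col B \<Longrightarrow>
   dsum A B $$ (i, j) = (if i < dim_row A then if j < dim_col A then A $$ (i, j) else 0
     else if j < dim_col A then 0 else B $$ (i - dim_row A, j - dim_col A))"
  by (simp add: dsum_def)

lemma dim_swap_mat [simp]: "dim_row (swap_mat n m) = m + n" "dim_col (swap_mat n m) = n + m"
  using swap_mat_carrier[of n m] by auto

text \<open>The matrices of morphisms that have a monoidal decomposition of width at most \<open>k\<close>, described
  without mentioning morphisms. At this level the generators come in transposed pairs, so a
  decomposition can be reflected; and products are computed entrywise, without coherence of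
  symmetries.\<close>

inductive narrow :: "nat \<Rightarrow> nat mat \<Rightarrow> bool" for k where
  copy: "2 \<le> k \<Longrightarrow> narrow k (mat 2 1 (\<lambda>_. 1))"
| add: "2 \<le> k \<Longrightarrow> narrow k (mat 1 2 (\<lambda>_. 1))"
| del: "1 \<le> k \<Longrightarrow> narrow k (0\<^sub>m 0 1)"
| zero: "1 \<le> k \<Longrightarrow> narrow k (0\<^sub>m 1 0)"
| ident_1: "1 \<le> k \<Longrightarrow> narrow k (1\<^sub>m 1)"
| swap_11: "2 \<le> k \<Longrightarrow> narrow k (swap_mat 1 1)"
| dsum: "narrow k A \<Longrightarrow> narrow k B \<Longrightarrow> narrow k (dsum A B)"
| mult: "narrow k A \<Longrightarrow> narrow k B \<Longrightarrow> dim_col A = dim_row B \<Longrightarrow> dim_row B \<le> k \<Longrightarrow> narrow k (A * B)"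

lemma narrow_mono: "narrow k A \<Longrightarrow> k \<le> l \<Longrightarrow> narrow l A"
  by (induction rule: narrow.induct) (auto intro: narrow.intros)

lemma transpose_swap_mat: "transpose_mat (swap_mat n m) = swap_mat m n"
  unfolding swap_mat_def
  by (subst transpose_four_block_mat[of _ m n _ m _ n]) auto

lemma transpose_dsum: "transpose_mat (dsum A B) = dsum (transpose_mat A) (transpose_mat B)"
  unfolding dsum_def
  by (subst transpose_four_block_mat[of _ "dim_row A" "dim_col A" _ "dim_col B" _ "dim_row B"]) auto

lemma narrow_transpose: "narrow k A \<Longrightarrow> narrow k (transpose_mat A)"
proof (induction rule: narrow.induct)
  case copy
  have "transpose_mat (mat 2 1 (\<lambda>_. 1 :: nat)) = mat 1 2 (\<lambda>_. 1)" by (rule eq_matI) auto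
  then show ?case using copy by (simp add: narrow.add)
next
  case add
  have "transpose_mat (mat 1 2 (\<lambda>_. 1 :: nat)) = mat 2 1 (\<lambda>_. 1)" by (rule eq_matI) auto
  then show ?case using add by (simp add: narrow.copy)
next
  case (mult A B)
  have "transpose_mat (A * B) = transpose_mat B * transpose_mat A"
    by (rule transpose_mult[of A "dim_row A" "dim_col A" B "dim_col B"]) (use mult in auto)
  then show ?case using mult by (auto intro: narrow.mult)
qed (auto simp: transpose_dsum transpose_swap_mat zero_transpose_mat transpose_one intro: narrow.intros)

lemma narrow_empty: "1 \<le> k \<Longrightarrow> narrow k (0\<^sub>m 0 0)"
  using narrow.mult[OF narrow.del narrow.zero, of k] by simp

lemma narrow_zero_inputs: "1 \<le> k \<Longrightarrow> narrow k (0\<^sub>m r 0)"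
proof (induction r)
  case (Suc r)
  have "0\<^sub>m (Suc r) 0 = dsum (0\<^sub>m 1 0) (0\<^sub>m r 0)"
    by (rule eq_matI) (auto simp: dsum_def)
  then show ?case using Suc by (auto intro: narrow.intros)
qed (rule narrow_empty)

lemma narrow_ident: "1 \<le> k \<Longrightarrow> narrow k (1\<^sub>m n)"
proof (induction n)
  case 0
  have "1\<^sub>m 0 = (0\<^sub>m 0 0 :: nat mat)" by (rule eq_matI) auto
  then show ?case using 0 narrow_empty by simp
next
  case (Suc n)
  have "1\<^sub>m (Suc n) = (dsum (1\<^sub>m 1) (1\<^sub>m n))"
    by (rule eq_matI) (auto simp: dsum_def)
  then show ?case using Suc by (auto intro: narrow.intros)
qed

lemma narrow_scalar: "2 \<le> k \<Longrightarrow> narrow k (mat 1 1 (\<lambda>_. c))"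
proof (induction c)
  case 0
  have "mat 1 1 (\<lambda>_. 0) = 0\<^sub>m 1 0 * (0\<^sub>m 0 1 :: nat mat)"
    by (rule eq_matI) (auto simp: scalar_prod_def)
  moreover have "narrow k (0\<^sub>m 1 0 * 0\<^sub>m 0 1)"
    by (rule narrow.mult) (use 0 in \<open>auto intro: narrow.intros\<close>)
  ultimately show ?case by (simp only:)
next
  case (Suc c)
  have "mat 1 1 (\<lambda>_. Suc c) = mat 1 2 (\<lambda>_. 1) * (dsum (1\<^sub>m 1) (mat 1 1 (\<lambda>_. c)) * mat 2 1 (\<lambda>_. 1))"
    by (rule eq_matI) (auto simp: concrete_simps)
  then show ?case using Suc by (auto intro!: narrow.intros)
qed

lemma narrow_add_multiple: "2 \<le> k \<Longrightarrow> narrow k (mat 1 2 (\<lambda>(i, j). if j = 0 then 1 else c))"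
proof -
  assume k: "2 \<le> k"
  have "mat 1 2 (\<lambda>(i, j). if j = 0 then 1 else c) = mat 1 2 (\<lambda>_. 1) * dsum (1\<^sub>m 1) (mat 1 1 (\<lambda>_. c))"
    by (rule eq_matI) (auto simp: concrete_simps)
  then show ?thesis using k by (auto intro!: narrow.intros narrow_scalar)
qed

text \<open>The matrix of \<open>(x, y) \<mapsto> (y, x + c * y)\<close>: a wire carrying \<open>y\<close> passes over the wire \<open>x\<close> and leaves a
  multiple of itself there.\<close>

definition pass_and_add :: "nat \<Rightarrow> nat mat" where
  "pass_and_add c = mat 2 2 (\<lambda>(i, j). if i = 1 \<and> j = 1 then c else if i = j then 0 else 1)"

lemma dim_pass_and_add [simp]: "dim_row (pass_and_add c) = 2" "dim_col (pass_and_add c) = 2"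
  by (simp_all add: pass_and_add_def)

text \<open>Width \<open>3\<close> arises here, since \<open>y\<close> must be copied while \<open>x\<close> is kept.\<close>

lemma narrow_pass_and_add: "3 \<le> k \<Longrightarrow> narrow k (pass_and_add c)"
proof -
  assume k: "3 \<le> k"
  have "pass_and_add c = swap_mat 1 1 * (dsum (mat 1 2 (\<lambda>(i, j). if j = 0 then 1 else c)) (1\<^sub>m 1)
      * dsum (1\<^sub>m 1) (mat 2 1 (\<lambda>_. 1)))"
    by (rule eq_matI) (auto simp: concrete_simps pass_and_add_def)
  then show ?thesis using k
    by (auto intro!: narrow.intros narrow_add_multiple)
qed

text \<open>The block matrix \<open>[I | b]\<close>, which adds the multiple \<open>b i\<close> of the last input to the \<open>i\<close>-th of the \<open>r\<close>
  other inputs.\<close>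

definition add_last :: "nat \<Rightarrow> (nat \<Rightarrow> nat) \<Rightarrow> nat mat" where
  "add_last r b = mat r (Suc r) (\<lambda>(i, j). if j = r then b i else if i = j then 1 else 0)"

lemma dim_add_last [simp]: "dim_row (add_last r b) = r" "dim_col (add_last r b) = Suc r"
  by (simp_all add: add_last_def)

lemma add_last_Suc:
  "add_last (Suc r) b = dsum (add_last r b) (1\<^sub>m 1) * dsum (1\<^sub>m r) (pass_and_add (b r))" (is "_ = ?L * ?R")
proof (rule eq_matI)
  fix i j
  assume "i < dim_row (?L * ?R)" "j < dim_col (?L * ?R)"
  then have i: "i < Suc r" and j: "j < Suc (Suc r)"
    by (auto simp: dsum_def add_last_def pass_and_add_def)
  have L: "?L $$ (i, l) = (if i < r then (if l < r then (if i = l then 1 else 0) else if l = r then b i else 0)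
      else (if l = Suc r then 1 else 0))" if "l < Suc (Suc r)" for l
    using that i by (auto simp: dsum_def add_last_def)
  have R: "?R $$ (l, j) = (if l < r then (if l = j then 1 else 0) else
      if j < r then 0 else if l = Suc r \<and> j = Suc r then b r else if l = j then 0 else 1)" if "l < Suc (Suc r)" for l
    using that j by (auto simp: dsum_def pass_and_add_def)
  have "(?L * ?R) $$ (i, j) = (\<Sum>l = 0..<Suc (Suc r). ?L $$ (i, l) * ?R $$ (l, j))"
    using i j by (simp add: scalar_prod_def flip: Suc_eq_plus1)
  also have "\<dots> = (\<Sum>l = 0..<r. ?L $$ (i, l) * ?R $$ (l, j))
      + ?L $$ (i, r) * ?R $$ (r, j) + ?L $$ (i, Suc r) * ?R $$ (Suc r, j)"
    by (simp only: sum.atLeast0_lessThan_Suc)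
  also have "(\<Sum>l = 0..<r. ?L $$ (i, l) * ?R $$ (l, j)) = (\<Sum>l = 0..<r. if l = i then (if l = j then 1 else 0) else 0)"
    by (rule sum.cong) (auto simp: L R)
  also have "\<dots> + ?L $$ (i, r) * ?R $$ (r, j) + ?L $$ (i, Suc r) * ?R $$ (Suc r, j) = add_last (Suc r) b $$ (i, j)"
    using i j L[of r] L[of "Suc r"] R[of r] R[of "Suc r"] by (auto simp: add_last_def less_Suc_eq)
  finally show "add_last (Suc r) b $$ (i, j) = (?L * ?R) $$ (i, j)" by simp
qed (auto simp: dsum_def add_last_def pass_and_add_def)

text \<open>The last input visits the other wires one at a time. A visit involves only one other wire, in a
  tensor factor of width \<open>3\<close>, and the remaining wires stay outside that factor. At the last wire the
  input is consumed instead of passed on, so that width \<open>2\<close> is enough there; this is what keeps the bound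
  \<open>Suc r\<close> for \<open>r = 1\<close>.\<close>

lemma narrow_add_last: "narrow (Suc r) (add_last r b)"
proof (induction r)
  case 0
  have "add_last 0 b = 0\<^sub>m 0 1" by (rule eq_matI) (auto simp: add_last_def)
  then show ?case by (auto intro: narrow.del)
next
  case (Suc r)
  show ?case
  proof (cases "r = 0")
    case True
    have "add_last 1 b = mat 1 2 (\<lambda>(i, j). if j = 0 then 1 else b 0)"
      by (rule eq_matI) (auto simp: add_last_def)
    then show ?thesis using True narrow_add_multiple[of "Suc (Suc 0)" "b 0"] by (simp add: One_nat_def)
  next
    case False
    then have "narrow (Suc (Suc r)) (dsum (1\<^sub>m r) (pass_and_add (b r)))"
      "narrow (Suc (Suc r)) (dsum (add_last r b) (1\<^sub>m 1))"
      by (auto intro!: narrow.intros narrow_ident narrow_pass_and_add narrow_mono[OF Suc])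
    then show ?thesis unfolding add_last_Suc
      by (auto intro!: narrow.mult simp: dsum_def add_last_def pass_and_add_def)
  qed
qed

lemma append_input:
  assumes "B \<in> carrier_mat r (Suc n)"
  shows "B = add_last r (\<lambda>i. B $$ (i, n)) * dsum (mat r n (\<lambda>(i, j). B $$ (i, j))) (1\<^sub>m 1)" (is "_ = ?L * ?R")
proof (rule eq_matI)
  fix i j
  assume "i < dim_row (?L * ?R)" "j < dim_col (?L * ?R)"
  then have i: "i < r" and j: "j < Suc n"
    by (auto simp: dsum_def add_last_def)
  have "(?L * ?R) $$ (i, j) = (\<Sum>l = 0..<Suc r. ?L $$ (i, l) * ?R $$ (l, j))"
    using i j by (simp add: scalar_prod_def flip: Suc_eq_plus1)
  also have "\<dots> = (\<Sum>l = 0..<r. ?L $$ (i, l) * ?R $$ (l, j)) + ?L $$ (i, r) * ?R $$ (r, j)"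
    by (simp only: sum.atLeast0_lessThan_Suc)
  also have "(\<Sum>l = 0..<r. ?L $$ (i, l) * ?R $$ (l, j)) = (\<Sum>l = 0..<r. if l = i then (if j < n then B $$ (l, j) else 0) else 0)"
    using i j by (intro sum.cong) (auto simp: add_last_def dsum_index)
  also have "\<dots> + ?L $$ (i, r) * ?R $$ (r, j) = B $$ (i, j)"
    using i j by (auto simp: add_last_def dsum_index less_Suc_eq)
  finally show "B $$ (i, j) = (?L * ?R) $$ (i, j)" by simp
qed (use assms in \<open>auto simp: dsum_def add_last_def\<close>)

text \<open>Inputs are absorbed one at a time. Between two steps only the \<open>r\<close> partial sums and the next input
  are cut: the first \<open>n\<close> inputs enter inside the tensor factor that computes these sums. Hence the
  width does not depend on the number of columns.\<close>

lemma narrow_Suc_dim_row: "B \<in> carrier_mat r n \<Longrightarrow> narrow (Suc r) B"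
proof (induction n arbitrary: B)
  case 0
  have "B = 0\<^sub>m r 0" using 0 by auto
  then show ?case by (simp add: narrow_zero_inputs)
next
  case (Suc n)
  let ?B = "mat r n (\<lambda>(i, j). B $$ (i, j))"
  have "narrow (Suc r) (dsum ?B (1\<^sub>m 1))"
    by (intro narrow.dsum Suc.IH narrow.ident_1) auto
  then show ?case
    by (subst append_input[OF Suc.prems])
      (intro narrow.mult narrow_add_last; simp add: dsum_def add_last_def)
qed

text \<open>By reflection, the number of columns gives the same bound.\<close>

lemma narrow_Suc_dim_col: "C \<in> carrier_mat m r \<Longrightarrow> narrow (Suc r) C"
  using narrow_transpose[OF narrow_Suc_dim_row[of "transpose_mat C" r m]] by simp

lemma mat_rank_factor: "\<exists>B \<in> carrier_mat (mat_rank A) (dim_col A). \<exists>C \<in> carrier_mat (dim_row A) (mat_rank A). A = C * B"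
  unfolding mat_rank_def
  by (rule LeastI[of _ "dim_row A"], rule bexI[of _ A], rule bexI[of _ "1\<^sub>m (dim_row A)"]) auto

lemma mat_rank_le: "B \<in> carrier_mat k (dim_col A) \<Longrightarrow> C \<in> carrier_mat (dim_row A) k \<Longrightarrow> A = C * B \<Longrightarrow> mat_rank A \<le> k"
  unfolding mat_rank_def by (rule Least_le) blast

lemma mat_rank_le_dim_row: "mat_rank A \<le> dim_row A"
  by (rule mat_rank_le[of A _ _ "1\<^sub>m (dim_row A)"]) auto

lemma mat_rank_le_dim_col: "mat_rank A \<le> dim_col A"
  by (rule mat_rank_le[of "1\<^sub>m (dim_col A)" _ _ A]) auto

text \<open>Cut along an optimal factorisation: each factor has one side of length \<open>mat_rank A\<close>.\<close>

lemma narrow_mat_rank: "narrow (Suc (mat_rank A)) A"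
proof -
  obtain B C where BC: "B \<in> carrier_mat (mat_rank A) (dim_col A)" "C \<in> carrier_mat (dim_row A) (mat_rank A)"
    "A = C * B"
    using mat_rank_factor[of A] by blast
  have "narrow (Suc (mat_rank A)) (C * B)"
    using BC(1,2) by (intro narrow.mult narrow_Suc_dim_row[OF BC(1)] narrow_Suc_dim_col[OF BC(2)]) auto
  then show ?thesis using BC(3) by simp
qed

lemma narrow_decomp: "narrow k A \<Longrightarrow> \<exists>f d. M f = A \<and> decomp_of d f \<and> width d \<le> k"
proof (induction rule: narrow.induct)
  case copy
  then show ?case by (intro exI[of _ copy] exI[of _ "Leaf copy"]) (auto simp: atomic_def intro: decomp_of.intros)
next
  case add
  then show ?case by (intro exI[of _ add] exI[of _ "Leaf add"]) (auto simp: atomic_def intro: decomp_of.intros)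
next
  case del
  then show ?case by (intro exI[of _ del] exI[of _ "Leaf del"]) (auto simp: atomic_def intro: decomp_of.intros)
next
  case zero
  then show ?case by (intro exI[of _ zero] exI[of _ "Leaf zero"]) (auto simp: atomic_def intro: decomp_of.intros)
next
  case ident_1
  then show ?case by (intro exI[of _ "ident 1"] exI[of _ "Leaf (ident 1)"]) (auto simp: atomic_def intro: decomp_of.intros)
next
  case swap_11
  then show ?case by (intro exI[of _ "swap 1 1"] exI[of _ "Leaf (swap 1 1)"]) (auto simp: atomic_def intro: decomp_of.intros)
next
  case (dsum A B)
  then obtain f d g e where "M f = A" "decomp_of d f" "width d \<le> k" "M g = B" "decomp_of e g" "width e \<le> k"
    by blast
  then show ?case
    by (intro exI[of _ "f \<otimes>\<^sub>B g"] exI[of _ "TensorNode d e"]) (auto intro: decomp_of.intros)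
next
  case (mult A B)
  then obtain f d g e where *: "M f = A" "decomp_of d f" "width d \<le> k" "M g = B" "decomp_of e g" "width e \<le> k"
    by blast
  then have "bcod g = bdom f" "bdom f \<le> k" using mult dim_M[of f] dim_M[of g] by auto
  with * show ?case
    by (intro exI[of _ "g ;; f"] exI[of _ "SeqNode e (bdom f) d"]) (auto intro: decomp_of.intros)
qed

text \<open>Faithfulness turns a decomposition of some morphism with matrix \<open>M f\<close> into a decomposition of \<open>f\<close>
  itself.\<close>

lemma decomp_width_le_Suc_rank: "\<exists>d. decomp_of d f \<and> width d \<le> Suc (mat_rank (M f))"
  using narrow_decomp[OF narrow_mat_rank[of "M f"]] M_injective by blast

lemma M_surjective: "\<exists>f. M f = A"
  using narrow_decomp[OF narrow_mat_rank[of A]] by blast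

section \<open>Indecomposable blocks bound the width\<close>

text \<open>The entries of \<open>F\<close> beside \<open>G\<close> are left arbitrary, so that a tensor factor of a morphism remains such a block when
  the morphism is cut by a tensor product that is unrelated to this factor.\<close>

definition window :: "nat \<Rightarrow> nat \<Rightarrow> nat mat \<Rightarrow> nat mat \<Rightarrow> bool" where
  "window p q G F \<longleftrightarrow> p + dim_row G \<le> dim_row F \<and> q + dim_col G \<le> dim_col F \<and>
    (\<forall>i < dim_row G. \<forall>j < dim_col G. G $$ (i, j) = F $$ (p + i, q + j))"

text \<open>A factorisation of a matrix restricts to each of its blocks.\<close>

lemma mat_rank_window_le:
  assumes "window p q G (C * B)" "dim_col C = dim_row B"
  shows "mat_rank G \<le> dim_row B"
proof (rule mat_rank_le)
  show "mat (dim_row B) (dim_col G) (\<lambda>(i, j). B $$ (i, q + j)) \<in> carrier_mat (dim_row B) (dim_col G)" (is "?B \<in> _")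
    and "mat (dim_row G) (dim_row B) (\<lambda>(i, j). C $$ (p + i, j)) \<in> carrier_mat (dim_row G) (dim_row B)" (is "?C \<in> _")
    by auto
  show "G = ?C * ?B"
    using assms unfolding window_def by (intro eq_matI) (auto simp: scalar_prod_def)
qed

text \<open>A trivial splitting is recognised by the dimensions of a summand, because for a nonempty block these
  already say on which side of a cut it lies.\<close>

definition dsum_irreducible :: "nat mat \<Rightarrow> bool" where
  "dsum_irreducible G \<longleftrightarrow> (\<forall>A B. G = dsum A B \<longrightarrow>
     dim_row A = dim_row G \<and> dim_col A = dim_col G \<or> dim_row B = dim_row G \<and> dim_col B = dim_col G)"

text \<open>The cut between \<open>A\<close> and \<open>B\<close>, clamped to the block \<open>G\<close>, splits \<open>G\<close> as a direct sum of an \<open>a \<times> b\<close>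
  matrix and its complement, because what lies off the diagonal is zero. This is so even if the cut
  meets the rows of \<open>G\<close> but passes beside its columns. By irreducibility one summand is trivial, so
  \<open>G\<close> lies within \<open>A\<close> or within \<open>B\<close>.\<close>

lemma window_dsum_irreducible:
  assumes win: "window p q G (dsum A B)" and irr: "dsum_irreducible G"
    and pos: "dim_row G > 0" "dim_col G > 0"
  shows "window p q G A \<or> window (p - dim_row A) (q - dim_col A) G B"
proof -
  \<comment> \<open>Truncated subtraction and \<open>min\<close> clamp the cut to the rows and columns of \<open>G\<close>.\<close>
  define a where "a = min (dim_row G) (dim_row A - p)"
  define b where "b = min (dim_col G) (dim_col A - q)"
  have "G = dsum (mat a b (\<lambda>(i, j). G $$ (i, j)))
      (mat (dim_row G - a) (dim_col G - b) (\<lambda>(i, j). G $$ (a + i, b + j)))" (is "_ = dsum ?G1 ?G2")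
  proof (rule eq_matI)
    fix i j
    assume "i < dim_row (dsum ?G1 ?G2)" "j < dim_col (dsum ?G1 ?G2)"
    then have i: "i < dim_row G" and j: "j < dim_col G"
      by (auto simp: a_def b_def)
    have "G $$ (i, j) = 0" if "(i < a) \<noteq> (j < b)"
    proof -
      have "G $$ (i, j) = dsum A B $$ (p + i, q + j)"
        using win i j by (simp add: window_def)
      also have "\<dots> = 0"
        using win i j that by (subst dsum_index) (auto simp: window_def a_def b_def)
      finally show ?thesis .
    qed
    then show "G $$ (i, j) = dsum ?G1 ?G2 $$ (i, j)"
      using i j by (subst dsum_index) (auto simp: a_def b_def)
  qed (auto simp: a_def b_def)
  then have "dim_row ?G1 = dim_row G \<and> dim_col ?G1 = dim_col G \<or>
      dim_row ?G2 = dim_row G \<and> dim_col ?G2 = dim_col G"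
    using irr unfolding dsum_irreducible_def by blast
  then consider "a = dim_row G" "b = dim_col G" | "a = 0" "b = 0"
    using pos by (auto simp: a_def b_def)
  then show ?thesis
  proof cases
    case 1
    then have le: "p + dim_row G \<le> dim_row A" "q + dim_col G \<le> dim_col A"
      using pos by (auto simp: a_def b_def)
    have "window p q G A"
      unfolding window_def
    proof (intro conjI le allI impI)
      fix i j assume "i < dim_row G" "j < dim_col G"
      then show "G $$ (i, j) = A $$ (p + i, q + j)"
        using win le dsum_index[of "p + i" A B "q + j"] by (auto simp: window_def)
    qed
    then show ?thesis ..
  next
    case 2
    then have le: "dim_row A \<le> p" "dim_col A \<le> q"
      using pos by (auto simp: a_def b_def)
    have "window (p - dim_row A) (q - dim_col A) G B"
      unfolding window_def
    proof (intro conjI allI impI)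
      fix i j assume "i < dim_row G" "j < dim_col G"
      then show "G $$ (i, j) = B $$ (p - dim_row A + i, q - dim_col A + j)"
        using win le dsum_index[of "p + i" A B "q + j"] by (auto simp: window_def)
    qed (use win le in \<open>auto simp: window_def\<close>)
    then show ?thesis ..
  qed
qed

text \<open>A cut along \<open>j\<close> wires gives a factorisation through \<open>j\<close>, so it bounds the rank of every block. A
  tensor node cannot split an irreducible block, so the block survives in one of the two
  subtrees. At a leaf the bound by a dimension is enough.\<close>

lemma mat_rank_le_width:
  "decomp_of d f \<Longrightarrow> window p q G (M f) \<Longrightarrow> dsum_irreducible G \<Longrightarrow> mat_rank G \<le> width d"
proof (induction arbitrary: p q rule: decomp_of.induct)
  case (1 f)
  then have "dim_row G \<le> bcod f" by (simp add: window_def)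
  then show ?case using mat_rank_le_dim_row[of G] by simp
next
  case (2 d1 f1 d2 f2)
  show ?case
  proof (cases "dim_row G = 0 \<or> dim_col G = 0")
    case True
    then show ?thesis using mat_rank_le_dim_row[of G] mat_rank_le_dim_col[of G] by auto
  next
    case False
    then have "window p q G (M f1) \<or> window (p - bcod f1) (q - bdom f1) G (M f2)"
      using window_dsum_irreducible[of p q G "M f1" "M f2"] 2 by simp
    then show ?thesis using 2 by (auto simp: le_max_iff_disj)
  qed
next
  case (3 d1 f1 d2 f2 j)
  then have "mat_rank G \<le> dim_row (M f1)"
    by (intro mat_rank_window_le[of p q G "M f2" "M f1"]) auto
  then show ?case using 3 by simp
qed

text \<open>Since every matrix is the matrix of a unique morphism, a splitting of the matrix is a splitting of
  the morphism.\<close>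

lemma dsum_irreducible_M:
  assumes "\<not> tensor_decomposable g"
  shows "dsum_irreducible (M g)"
  unfolding dsum_irreducible_def
proof (intro allI impI)
  fix A B assume AB: "M g = dsum A B"
  obtain f1 f2 where f: "M f1 = A" "M f2 = B" using M_surjective by blast
  then have "g = f1 \<otimes>\<^sub>B f2" using AB by (intro M_injective) simp
  then have "f1 = g \<or> f2 = g" using assms unfolding tensor_decomposable_def by blast
  then show "dim_row A = dim_row (M g) \<and> dim_col A = dim_col (M g) \<or>
    dim_row B = dim_row (M g) \<and> dim_col B = dim_col (M g)"
    using f by blast
qed

lemma window_tensor_list:
  "g \<in> set fs \<Longrightarrow> \<exists>p q. window p q (M g) (M (tensor_list fs))"
proof (induction fs)
  case (Cons f fs)
  have M: "M (tensor_list (f # fs)) = dsum (M f) (M (tensor_list fs))"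
    by (simp add: tensor_list_def)
  show ?case
  proof (cases "g = f")
    case True
    then have "window 0 0 (M g) (M (tensor_list (f # fs)))"
      by (auto simp: window_def M dsum_index)
    then show ?thesis by blast
  next
    case False
    then obtain p q where pq: "window p q (M g) (M (tensor_list fs))" using Cons by auto
    then have "window (bcod f + p) (bdom f + q) (M g) (M (tensor_list (f # fs)))"
      by (auto simp: window_def M dsum_index add.assoc)
    then show ?thesis by blast
  qed
qed simp

text \<open>The empty product is the identity of \<open>0\<close>, which still needs a decomposition of width \<open>1\<close>, namely
  \<open>zero ;; del\<close>; hence the bound on \<open>k\<close>.\<close>

lemma decomp_tensor_list:
  assumes "\<And>g. g \<in> set fs \<Longrightarrow> \<exists>d. decomp_of d g \<and> width d \<le> k" "1 \<le> k"
  shows "\<exists>d. decomp_of d (tensor_list fs) \<and> width d \<le> k"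
  using assms(1)
proof (induction fs)
  case Nil
  have "\<exists>f d. M f = 0\<^sub>m 0 0 \<and> decomp_of d f \<and> width d \<le> k"
    using assms(2) by (intro narrow_decomp narrow_empty)
  moreover have "M (ident 0) = 0\<^sub>m 0 0" by (auto intro: eq_matI)
  ultimately show ?case using M_injective by (metis tensor_list_def foldr.simps(1) id_apply)
next
  case (Cons f fs)
  then obtain d e where "decomp_of d f" "width d \<le> k" "decomp_of e (tensor_list fs)" "width e \<le> k"
    by (metis list.set_intros)
  then show ?case
    by (intro exI[of _ "TensorNode d e"]) (auto simp: tensor_list_def intro: decomp_of.intros)
qed

section \<open>Monoidal width and rank\<close>

theorem theorem3p12:
  fixes f :: bialg and fs :: "bialg list"
  assumes "fs \<noteq> []"
    and "f = tensor_list fs"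
    and "\<And>g. g \<in> set fs \<Longrightarrow> \<not> tensor_decomposable g"
  shows "Max ((\<lambda>g. mat_rank (M g)) ` set fs) \<le> mwd f
    \<and> mwd f \<le> Max ((\<lambda>g. mat_rank (M g)) ` set fs) + 1"
proof
  let ?r = "Max ((\<lambda>g. mat_rank (M g)) ` set fs)"
  have "\<exists>d. decomp_of d g \<and> width d \<le> ?r + 1" if "g \<in> set fs" for g
  proof -
    have "mat_rank (M g) \<le> ?r" using that by (intro Max_ge) auto
    then show ?thesis using decomp_width_le_Suc_rank[of g] by (metis Suc_eq_plus1 Suc_le_mono le_trans)
  qed
  then obtain d where d: "decomp_of d f" "width d \<le> ?r + 1"
    using decomp_tensor_list[of fs "?r + 1"] assms(2) by auto
  have "mwd f \<le> width d"
    unfolding mwd_def using d by (intro Least_le) blast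
  with d show "mwd f \<le> ?r + 1" by simp
  have "\<exists>d. decomp_of d f \<and> width d = mwd f"
    unfolding mwd_def by (rule LeastI[of _ "width d"]) (use d in blast)
  then obtain d' where d': "decomp_of d' f" "width d' = mwd f" by blast
  have "mat_rank (M g) \<le> mwd f" if "g \<in> set fs" for g
    using window_tensor_list[OF that] mat_rank_le_width[OF d'(1)] dsum_irreducible_M[OF assms(3)[OF that]]
      assms(2) d'(2) by auto
  then show "?r \<le> mwd f"
    using assms(1) by (subst Max_le_iff) auto
qed

end
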